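(* Let $\{z^{(k)}\}$ be the iterate sequence generated by PALM-I (described in the context, with $M_l=\gamma L$, $\gamma>1$, $M_u=M\ge M_l$), with $\varepsilon^{(k)}=\bar\varepsilon\tilde\rho^{\,k}$ for all $k\ge 0$, where $\tilde\rho\in(0,1)$. Suppose that: (1) for each $i=1,\ldots,n$ there is $L_i>0$ such that $\|\nabla_i f(z_1)-\nabla_i f(z_2)\|\le L_i\|z_1-z_2\|$ for all $z_1,z_2\in\prod_{j=1}^n\bar{\mathcal S}_j$; (2) for each $i=1,\ldots,n$, $\mathcal S_i$ is convex and compact, $h_i$ is linear or satisfies the Slater constraint qualification (there is $\hat x_i\in\mathbb R^{m_i}$ with $h_i(\hat x_i)<0$), and there is a constant $\tilde c_i\ge 0$ such that $\mathrm{dist}(x_i,\mathcal S_i)\le \tilde c_i\|\max\{h_i(x_i),0\}\|$ for all $x_i\in\tilde{\mathcal S}_i$; (3) $F$ has the Łojasiewicz property at each of its stationary points; (4) there exists $\bar\theta\in(0,1)$ such that $\{(e^{(k)})^{\bar\theta}\}$ is summable, where $e^{(k)}:=\sum_{t=k}^\infty(\varepsilon^{(t)})^2$, and $\{\varepsilon^{(k)}\}$ is summable. Let $\bar z$ be the unique limit point of $\{z^{(k)}\}$ and let $\theta\in[0,1)$ be the Łojasiewicz exponent of $F$ at $\bar z$. Assume that $v^{(k)}>\overline F$ for any $k\ge 0$, where $v^{(k)}$ and $\overline F$ are as defined in the context. (i) If $\theta=0$, then there exists $\rho_1\in(0,1)$ such that $\|z^{(k)}-\bar z\|\le\mathcal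 O(\rho_1^k)$ for all sufficiently large $k$. (ii) If $\theta\in(0,\frac12]$, then there exists $\rho_2\in(0,1)$ such that $\|z^{(k)}-\bar z\|\le\mathcal O(\rho_2^k)$ for all sufficiently large $k$. (iii) If $\theta\in(\frac12,1)$, then $\|z^{(k)}-\bar z\|\le\mathcal O\big(k^{-\frac{1-\theta}{2\theta-1}}\big)$ for all sufficiently large $k$.
   Context: Problem. $n,m_i,p_i$ are positive integers; $f:\prod_{i=1}^n\mathbb R^{m_i}\to\mathbb R$ is differentiable (not necessarily convex); for $i=1,\ldots,n$, $h_i=(h_{i,1},\ldots,h_{i,p_i})^\top:\mathbb R^{m_i}\to\mathbb R^{p_i}$ is convex and differentiable, and $\mathcal S_i:=\{w\in\mathbb R^{m_i}: h_i(w)\le 0\}$. Write $z=(x_1,\ldots,x_n)$ with $x_i\in\mathbb R^{m_i}$, and $F(z):=f(z)+\sum_{i=1}^n\delta_{\mathcal S_i}(x_i)$, where $\delta_{\mathcal S}$ is the indicator function ($0$ on $\mathcal S$, $+\infty$ off $\mathcal S$). $\nabla_i f$ is the gradient of $f$ with respect to $x_i$; $\nabla h_i(x_i)\in\mathbb R^{m_i\times p_i}$ has as columns the gradients of the components of $h_i$; $\|\cdot\|$ is the Euclidean norm; inequalities and $\max\{\cdot,0\}$ of vectors are componentwise; $\mathrm{dist}(w,\mathcal S)=\inf_{w'\in\mathcal S}\|w-w'\|$. $x_{<i}=(x_1,\ldots,x_{i-1})$, and similarly $x_{\ge i}$, etc. Residual. $r_i(x_i,\lambda_i,\tilde x_i):=\max\{\langle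 x_i,x_i-\tilde x_i+\nabla h_i(x_i)\lambda_i\rangle,0\}+\|x_i-\tilde x_i+\nabla h_i(x_i)\lambda_i\|_\infty+\|\max\{h_i(x_i),0\}\|_\infty+\max\{-\langle\lambda_i,h_i(x_i)\rangle,0\}$. PALM-I. Inputs: $z^{(0)}\in\prod_i\mathbb R^{m_i}$, $\bar\varepsilon>0$, a nonnegative sequence $\{\varepsilon^{(k)}\}$ with $\varepsilon^{(k)}\le\bar\varepsilon$, $M_u\ge M_l>0$, and $\sigma_i^{(0)}\in[M_l,M_u]$. For $k=0,1,2,\ldots$ and, successively, $i=1,\ldots,n$: put $\tilde x_i^{(k)}:=x_i^{(k)}-\frac{1}{\sigma_i^{(k)}}\nabla_i f(x_{<i}^{(k+1)},x_{\ge i}^{(k)})$; choose $x_i^{(k+1)}\in\mathbb R^{m_i}$ (not necessarily in $\mathcal S_i$) for which there is $\lambda_i^{(k+1)}\in\mathbb R_+^{p_i}$ with $\sqrt{r_i(x_i^{(k+1)},\lambda_i^{(k+1)},\tilde x_i^{(k)})}\le\varepsilon^{(k)}$; choose $\sigma_i^{(k+1)}\in[M_l,M_u]$. This generates $z^{(k)}=(x_1^{(k)},\ldots,x_n^{(k)})$. The exact subproblem solutions along the run are $\bar x_i^{(k+1)}:=\arg\min_{x_i\in\mathcal S_i}\langle\nabla_i f(x_{<i}^{(k+1)},x_{\ge i}^{(k)}),x_i-x_i^{(k)}\rangle+\frac{\sigma_i^{(k)}}{2}\|x_i-x_i^{(k)}\|^2$, with $\bar z^{(k)}:=(\bar x_1^{(k)},\ldots,\bar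 x_n^{(k)})$ for $k\ge1$, and $\Delta z^{(k)}:=\bar z^{(k)}-z^{(k)}$. Convention: $\bar z^{(0)}$ is an arbitrary fixed point of $\prod_i\mathcal S_i$. Further notation. $\bar{\mathcal S}_i:=\{w\in\mathbb R^{m_i}:\mathrm{dist}(w,\mathcal S_i)\le\bar\varepsilon\}$; $\bar{\mathcal M}_i:=\sup_{z\in\prod_j\bar{\mathcal S}_j}\|\nabla_i f(z)\|$; $\tilde{\mathcal S}_i:=\{w\in\mathbb R^{m_i}:\mathrm{dist}(w,\bar{\mathcal S}_i)\le\bar{\mathcal M}_i/M_l\}$. $L:=\max_i L_i$; the algorithm is run with $M_l=\gamma L$ for some $\gamma>1$ and $M_u=M$ any scalar with $M\ge M_l$. $\nu:=\frac{12}{\gamma-1}$, $\bar\sigma^{(k)}:=\max_i\sigma_i^{(k)}$, $C_1^{(k)}:=\frac12\big(\bar\sigma^{(k)}+L[\frac{\nu}{2}n^2+(2+\frac{2}{\nu}-\frac{\nu}{2})n+2\nu+\frac{4}{\nu}+3]\big)$, $u^{(k)}:=\sum_{t=k}^\infty C_1^{(t)}\|\Delta z^{(t)}\|^2$, $v^{(k)}:=F(\bar z^{(k)})+u^{(k)}+u^{(k+1)}$. Under hypotheses (1), (2), (4) the sequence $\{v^{(k)}\}$ is well defined and converges; $\overline F$ denotes its limit. Under hypotheses (1)–(4) the sequence $\{z^{(k)}\}$ converges to a stationary point of $F$. "$a_k\le\mathcal O(b_k)$ for all sufficiently large $k$" means there is a constant $C$ (independent of $k$) with $a_k\le Cb_k$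 for all sufficiently large $k$. Subdifferential and Łojasiewicz property. For a proper closed $G:\mathbb E\to(-\infty,\infty]$ on a Euclidean space and $x\in\mathrm{dom}(G)$, $\partial G(x):=\{u\in\mathbb E:\liminf_{y\ne x,y\to x}\frac{G(y)-G(x)-\langle u,y-x\rangle}{\|y-x\|}\ge 0\}$ (Fréchet subdifferential), and $\partial G(x)=\emptyset$ otherwise. $x$ is a stationary point of $G$ if $0\in\partial G(x)$. $G$ has the Łojasiewicz property at a stationary point $\bar x$ if there are $c>0$, $\theta\in[0,1)$, $\eta>0$ such that $|G(x)-G(\bar x)|^\theta\le c\cdot\mathrm{dist}(0,\partial G(x))$ for all $x$ in the closed ball of radius $\eta$ around $\bar x$, with the convention $0^0=0$ if $\theta=0$ (so $|G(x)-G(\bar x)|^0=0$ means $G(x)=G(\bar x)$); $\theta$ is the Łojasiewicz exponent of $G$ at $\bar x$. *)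

theory Defs
  imports "HOL-Analysis.Analysis"
begin

text \<open>
  Since the blocks have different dimensions, the product of the spaces $R^{m_i}$, $i = 1, \dots, n$,
  is represented as \<^typ>\<open>real ^ 'N\<close> together with a map \<open>blk\<close> that assigns to every
  coordinate the number of the block it belongs to; \<open>range blk = {1..n}\<close> says that there are
  $n$ blocks and that every $m_i$, the number of coordinates \<open>j\<close> with \<open>blk j = i\<close>,
  is positive.  The space $R^{m_i}$ is the coordinate subspace of the vectors supported on the $i$-th
  block; norm, inner product and infinity norm of the ambient space restrict to those of $R^{m_i}$.
  A function on $R^{m_i}$ is a function on the ambient type of which only the restriction to this
  subspace is used.
\<close>

definition block_space :: "('N::finite \<Rightarrow> nat) \<Rightarrow> nat \<Rightarrow> (real ^ 'N) set" where
  "block_space blk i = {w. \<forall>j. blk j \<noteq> i \<longrightarrow> w $ j = 0}"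

definition block_of :: "('N::finite \<Rightarrow> nat) \<Rightarrow> nat \<Rightarrow> real ^ 'N \<Rightarrow> real ^ 'N" where
  "block_of blk i z = (\<chi> j. if blk j = i then z $ j else 0)"

definition replace_block ::
  "('N::finite \<Rightarrow> nat) \<Rightarrow> nat \<Rightarrow> real ^ 'N \<Rightarrow> real ^ 'N \<Rightarrow> real ^ 'N" where
  "replace_block blk i w z = (\<chi> j. if blk j = i then w $ j else z $ j)"

definition block_prod ::
  "('N::finite \<Rightarrow> nat) \<Rightarrow> nat \<Rightarrow> (nat \<Rightarrow> (real ^ 'N) set) \<Rightarrow> (real ^ 'N) set" where
  "block_prod blk n A = {z. \<forall>i\<in>{1..n}. block_of blk i z \<in> A i}"

text \<open>
  The gradient at \<open>x \<in> V\<close> of a function on a linear subspace \<open>V\<close>.  The requirement that the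
  gradient lies in \<open>V\<close> makes it unique.
\<close>

definition grad_on :: "'a::euclidean_space set \<Rightarrow> ('a \<Rightarrow> real) \<Rightarrow> 'a \<Rightarrow> 'a" where
  "grad_on V g x = (THE u. u \<in> V \<and> (g has_derivative (\<lambda>d. u \<bullet> d)) (at x within V))"

definition block_grad ::
  "('N::finite \<Rightarrow> nat) \<Rightarrow> (real ^ 'N \<Rightarrow> real) \<Rightarrow> nat \<Rightarrow> real ^ 'N \<Rightarrow> real ^ 'N" where
  "block_grad blk f i z =
     grad_on (block_space blk i) (\<lambda>w. f (replace_block blk i w z)) (block_of blk i z)"


subsection \<open>Constraint sets and objective\<close>

text \<open>
  \<open>p i\<close> is the number of components of $h_i$ and \<open>h i l\<close>, for \<open>l \<in> {1..p i}\<close>, is its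
  \<open>l\<close>-th component.  Vectors in $R^{p_i}$ are functions on \<open>{1..p i}\<close>.
\<close>

definition feas :: "('N::finite \<Rightarrow> nat) \<Rightarrow> (nat \<Rightarrow> nat) \<Rightarrow> (nat \<Rightarrow> nat \<Rightarrow> real ^ 'N \<Rightarrow> real) \<Rightarrow>
    nat \<Rightarrow> (real ^ 'N) set" where
  "feas blk p h i = {w \<in> block_space blk i. \<forall>l\<in>{1..p i}. h i l w \<le> 0}"

definition indicator_fun :: "'a set \<Rightarrow> 'a \<Rightarrow> ereal" where
  "indicator_fun A x = (if x \<in> A then 0 else \<infinity>)"

definition objective :: "('N::finite \<Rightarrow> nat) \<Rightarrow> nat \<Rightarrow> (nat \<Rightarrow> nat) \<Rightarrow> (real ^ 'N \<Rightarrow> real) \<Rightarrow>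
    (nat \<Rightarrow> nat \<Rightarrow> real ^ 'N \<Rightarrow> real) \<Rightarrow> real ^ 'N \<Rightarrow> ereal" where
  "objective blk n p f h z =
     ereal (f z) + (\<Sum>i\<in>{1..n}. indicator_fun (feas blk p h i) (block_of blk i z))"

definition feas_bar :: "('N::finite \<Rightarrow> nat) \<Rightarrow> (nat \<Rightarrow> nat) \<Rightarrow>
    (nat \<Rightarrow> nat \<Rightarrow> real ^ 'N \<Rightarrow> real) \<Rightarrow> real \<Rightarrow> nat \<Rightarrow> (real ^ 'N) set" where
  "feas_bar blk p h \<epsilon>bar i = {w \<in> block_space blk i. infdist w (feas blk p h i) \<le> \<epsilon>bar}"

definition grad_sup :: "('N::finite \<Rightarrow> nat) \<Rightarrow> nat \<Rightarrow> (nat \<Rightarrow> nat) \<Rightarrow> (real ^ 'N \<Rightarrow> real) \<Rightarrow>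
    (nat \<Rightarrow> nat \<Rightarrow> real ^ 'N \<Rightarrow> real) \<Rightarrow> real \<Rightarrow> nat \<Rightarrow> real" where
  "grad_sup blk n p f h \<epsilon>bar i =
     (SUP z\<in>block_prod blk n (feas_bar blk p h \<epsilon>bar). norm (block_grad blk f i z))"

definition feas_tilde :: "('N::finite \<Rightarrow> nat) \<Rightarrow> nat \<Rightarrow> (nat \<Rightarrow> nat) \<Rightarrow> (real ^ 'N \<Rightarrow> real) \<Rightarrow>
    (nat \<Rightarrow> nat \<Rightarrow> real ^ 'N \<Rightarrow> real) \<Rightarrow> real \<Rightarrow> real \<Rightarrow> nat \<Rightarrow> (real ^ 'N) set" where
  "feas_tilde blk n p f h \<epsilon>bar Ml i =
     {w \<in> block_space blk i. infdist w (feas_bar blk p h \<epsilon>bar i) \<le> grad_sup blk n p f h \<epsilon>bar i / Ml}"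

text \<open>As usual for constraint functions, ``linear'' includes a constant term.\<close>

definition linear_constraints :: "('N::finite \<Rightarrow> nat) \<Rightarrow> (nat \<Rightarrow> nat) \<Rightarrow>
    (nat \<Rightarrow> nat \<Rightarrow> real ^ 'N \<Rightarrow> real) \<Rightarrow> nat \<Rightarrow> bool" where
  "linear_constraints blk p h i \<longleftrightarrow>
     (\<forall>l\<in>{1..p i}. \<exists>a b. \<forall>w\<in>block_space blk i. h i l w = a \<bullet> w + b)"

definition slater :: "('N::finite \<Rightarrow> nat) \<Rightarrow> (nat \<Rightarrow> nat) \<Rightarrow>
    (nat \<Rightarrow> nat \<Rightarrow> real ^ 'N \<Rightarrow> real) \<Rightarrow> nat \<Rightarrow> bool" where
  "slater blk p h i \<longleftrightarrow> (\<exists>w\<in>block_space blk i. \<forall>l\<in>{1..p i}. h i l w < 0)"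


subsection \<open>Subdifferential and Lojasiewicz property\<close>

definition frechet_subdiff :: "('a::euclidean_space \<Rightarrow> ereal) \<Rightarrow> 'a \<Rightarrow> 'a set" where
  "frechet_subdiff G x =
     {u. G x < \<infinity> \<and>
         0 \<le> Liminf (at x) (\<lambda>y. (G y - G x - ereal (u \<bullet> (y - x))) / ereal (norm (y - x)))}"

definition stationary :: "('a::euclidean_space \<Rightarrow> ereal) \<Rightarrow> 'a \<Rightarrow> bool" where
  "stationary G x \<longleftrightarrow> 0 \<in> frechet_subdiff G x"

text \<open>
  Real powers of a nonnegative extended real.  The convention $0^0 = 0$ needed here is that of
  \<^const>\<open>powr\<close>.
\<close>

definition epowr :: "ereal \<Rightarrow> real \<Rightarrow> ereal" where
  "epowr a \<theta> = (if a = \<infinity> then \<infinity> else ereal (real_of_ereal a powr \<theta>))"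

text \<open>
  The distance from 0 to the subdifferential is taken in the extended reals, so that it is infinite
  if the subdifferential is empty (where \<^const>\<open>infdist\<close> would be 0).
\<close>

definition lojasiewicz_exponent :: "('a::euclidean_space \<Rightarrow> ereal) \<Rightarrow> 'a \<Rightarrow> real \<Rightarrow> bool" where
  "lojasiewicz_exponent G x \<theta> \<longleftrightarrow> 0 \<le> \<theta> \<and> \<theta> < 1 \<and>
     (\<exists>c>0. \<exists>\<eta>>0. \<forall>y\<in>cball x \<eta>.
        epowr \<bar>G y - G x\<bar> \<theta> \<le> ereal c * (INF u\<in>frechet_subdiff G y. ereal (dist 0 u)))"

definition lojasiewicz :: "('a::euclidean_space \<Rightarrow> ereal) \<Rightarrow> 'a \<Rightarrow> bool" where
  "lojasiewicz G x \<longleftrightarrow> (\<exists>\<theta>. lojasiewicz_exponent G x \<theta>)"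


subsection \<open>The algorithm\<close>

text \<open>The point $(x_{<i}^{(k+1)}, x_{\ge i}^{(k)})$.\<close>

definition mixed :: "('N::finite \<Rightarrow> nat) \<Rightarrow> (nat \<Rightarrow> real ^ 'N) \<Rightarrow> nat \<Rightarrow> nat \<Rightarrow> real ^ 'N" where
  "mixed blk z k i = (\<chi> j. if blk j < i then z (Suc k) $ j else z k $ j)"

definition x_tilde :: "('N::finite \<Rightarrow> nat) \<Rightarrow> (real ^ 'N \<Rightarrow> real) \<Rightarrow> (nat \<Rightarrow> nat \<Rightarrow> real) \<Rightarrow>
    (nat \<Rightarrow> real ^ 'N) \<Rightarrow> nat \<Rightarrow> nat \<Rightarrow> real ^ 'N" where
  "x_tilde blk f \<sigma> z k i =
     block_of blk i (z k) - (1 / \<sigma> k i) *\<^sub>R block_grad blk f i (mixed blk z k i)"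

definition residual :: "('N::finite \<Rightarrow> nat) \<Rightarrow> (nat \<Rightarrow> nat) \<Rightarrow>
    (nat \<Rightarrow> nat \<Rightarrow> real ^ 'N \<Rightarrow> real) \<Rightarrow> nat \<Rightarrow> real ^ 'N \<Rightarrow> (nat \<Rightarrow> real) \<Rightarrow> real ^ 'N \<Rightarrow> real" where
  "residual blk p h i x lam xt =
     (let g = x - xt + (\<Sum>l\<in>{1..p i}. lam l *\<^sub>R grad_on (block_space blk i) (h i l) x)
      in max (x \<bullet> g) 0 + infnorm g + (MAX l\<in>{1..p i}. \<bar>max (h i l x) 0\<bar>)
         + max (- (\<Sum>l\<in>{1..p i}. lam l * h i l x)) 0)"

text \<open>
  \<open>z\<close> and the step parameters \<open>\<sigma>\<close> (\<open>\<sigma> k i\<close> is $\sigma_i^{(k)}$) are produced by a run of PALM-I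
  with initial point \<open>z 0\<close>.
\<close>

definition palm_I :: "('N::finite \<Rightarrow> nat) \<Rightarrow> nat \<Rightarrow> (nat \<Rightarrow> nat) \<Rightarrow> (real ^ 'N \<Rightarrow> real) \<Rightarrow>
    (nat \<Rightarrow> nat \<Rightarrow> real ^ 'N \<Rightarrow> real) \<Rightarrow> real \<Rightarrow> (nat \<Rightarrow> real) \<Rightarrow> real \<Rightarrow> real \<Rightarrow>
    (nat \<Rightarrow> nat \<Rightarrow> real) \<Rightarrow> (nat \<Rightarrow> real ^ 'N) \<Rightarrow> bool" where
  "palm_I blk n p f h \<epsilon>bar \<epsilon> Ml Mu \<sigma> z \<longleftrightarrow>
     0 < \<epsilon>bar \<and> (\<forall>k. 0 \<le> \<epsilon> k \<and> \<epsilon> k \<le> \<epsilon>bar) \<and> 0 < Ml \<and> Ml \<le> Mu \<and>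
     (\<forall>k. \<forall>i\<in>{1..n}. Ml \<le> \<sigma> k i \<and> \<sigma> k i \<le> Mu) \<and>
     (\<forall>k. \<forall>i\<in>{1..n}. \<exists>lam. (\<forall>l\<in>{1..p i}. 0 \<le> lam l) \<and>
        sqrt (residual blk p h i (block_of blk i (z (Suc k))) lam (x_tilde blk f \<sigma> z k i)) \<le> \<epsilon> k)"

text \<open>The solution $\bar x_i^{(k+1)}$ of the exact subproblem.\<close>

definition x_bar :: "('N::finite \<Rightarrow> nat) \<Rightarrow> (nat \<Rightarrow> nat) \<Rightarrow> (real ^ 'N \<Rightarrow> real) \<Rightarrow>
    (nat \<Rightarrow> nat \<Rightarrow> real ^ 'N \<Rightarrow> real) \<Rightarrow> (nat \<Rightarrow> nat \<Rightarrow> real) \<Rightarrow> (nat \<Rightarrow> real ^ 'N) \<Rightarrow>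
    nat \<Rightarrow> nat \<Rightarrow> real ^ 'N" where
  "x_bar blk p f h \<sigma> z k i = arg_min_on
     (\<lambda>x. block_grad blk f i (mixed blk z k i) \<bullet> (x - block_of blk i (z k))
          + \<sigma> k i / 2 * (norm (x - block_of blk i (z k)))\<^sup>2)
     (feas blk p h i)"

text \<open>The sequence $\bar z^{(k)}$; its initial term \<open>zb0\<close> is free.\<close>

fun z_bar :: "('N::finite \<Rightarrow> nat) \<Rightarrow> (nat \<Rightarrow> nat) \<Rightarrow> (real ^ 'N \<Rightarrow> real) \<Rightarrow>
    (nat \<Rightarrow> nat \<Rightarrow> real ^ 'N \<Rightarrow> real) \<Rightarrow> (nat \<Rightarrow> nat \<Rightarrow> real) \<Rightarrow> (nat \<Rightarrow> real ^ 'N) \<Rightarrow>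
    real ^ 'N \<Rightarrow> nat \<Rightarrow> real ^ 'N" where
  "z_bar blk p f h \<sigma> z zb0 0 = zb0"
| "z_bar blk p f h \<sigma> z zb0 (Suc k) = (\<chi> j. x_bar blk p f h \<sigma> z k (blk j) $ j)"

definition C1 :: "nat \<Rightarrow> real \<Rightarrow> real \<Rightarrow> (nat \<Rightarrow> nat \<Rightarrow> real) \<Rightarrow> nat \<Rightarrow> real" where
  "C1 n \<gamma> L \<sigma> k =
     (let \<nu> = 12 / (\<gamma> - 1); \<sigma>bar = (MAX i\<in>{1..n}. \<sigma> k i)
      in 1 / 2 * (\<sigma>bar + L * (\<nu> / 2 * (real n)\<^sup>2 + (2 + 2 / \<nu> - \<nu> / 2) * real n
           + 2 * \<nu> + 4 / \<nu> + 3)))"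

definition u_seq :: "('N::finite \<Rightarrow> nat) \<Rightarrow> nat \<Rightarrow> (nat \<Rightarrow> nat) \<Rightarrow> (real ^ 'N \<Rightarrow> real) \<Rightarrow>
    (nat \<Rightarrow> nat \<Rightarrow> real ^ 'N \<Rightarrow> real) \<Rightarrow> real \<Rightarrow> real \<Rightarrow> (nat \<Rightarrow> nat \<Rightarrow> real) \<Rightarrow>
    (nat \<Rightarrow> real ^ 'N) \<Rightarrow> real ^ 'N \<Rightarrow> nat \<Rightarrow> real" where
  "u_seq blk n p f h \<gamma> L \<sigma> z zb0 k =
     (\<Sum>t. C1 n \<gamma> L \<sigma> (k + t) * (norm (z_bar blk p f h \<sigma> z zb0 (k + t) - z (k + t)))\<^sup>2)"

definition v_seq :: "('N::finite \<Rightarrow> nat) \<Rightarrow> nat \<Rightarrow> (nat \<Rightarrow> nat) \<Rightarrow> (real ^ 'N \<Rightarrow> real) \<Rightarrow>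
    (nat \<Rightarrow> nat \<Rightarrow> real ^ 'N \<Rightarrow> real) \<Rightarrow> real \<Rightarrow> real \<Rightarrow> (nat \<Rightarrow> nat \<Rightarrow> real) \<Rightarrow>
    (nat \<Rightarrow> real ^ 'N) \<Rightarrow> real ^ 'N \<Rightarrow> nat \<Rightarrow> ereal" where
  "v_seq blk n p f h \<gamma> L \<sigma> z zb0 k =
     objective blk n p f h (z_bar blk p f h \<sigma> z zb0 k)
     + ereal (u_seq blk n p f h \<gamma> L \<sigma> z zb0 k)
     + ereal (u_seq blk n p f h \<gamma> L \<sigma> z zb0 (Suc k))"

definition e_seq :: "(nat \<Rightarrow> real) \<Rightarrow> nat \<Rightarrow> real" where
  "e_seq \<epsilon> k = (\<Sum>t. (\<epsilon> (k + t))\<^sup>2)"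

definition limit_point :: "(nat \<Rightarrow> 'a::topological_space) \<Rightarrow> 'a \<Rightarrow> bool" where
  "limit_point x l \<longleftrightarrow> (\<exists>r. strict_mono r \<and> (x \<circ> r) \<longlonglongrightarrow> l)"

definition eventually_le_O :: "(nat \<Rightarrow> real) \<Rightarrow> (nat \<Rightarrow> real) \<Rightarrow> bool" where
  "eventually_le_O a b \<longleftrightarrow> (\<exists>C. \<forall>\<^sub>F k in sequentially. a k \<le> C * b k)"

end

theory Submission
  imports Defs
begin

text \<open>
  The proof compares the computed points \<open>z k\<close> with the exact subproblem solutions \<open>y k\<close>, which are
  feasible, and treats \<open>y\<close> as a descent sequence with summable errors.

  A bound on the residual is a perturbed variational inequality: testing the approximate optimality
  conditions with feasible points and using convexity of the constraints, the multipliers disappear,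
  however large they are.  Since \<open>y (k + 1)\<close> is in every block the projection of the gradient step,
  the squared distance of its block to that of \<open>z (k + 1)\<close> is bounded by a multiple of the sum of
  $\varepsilon_k^2$ and the infeasibility of the latter, and the error bound makes the infeasibility
  $O(\varepsilon_k^2)$ as well.  The error bound is assumed on a neighbourhood of the feasible set
  only, but for convex constraints it extends to the whole space (\<open>error_bound_extends\<close>).  Hence
  $\|y_k - z_k\| = O(\rho^k)$ (\<open>inexactness_geometric\<close>).  As a by-product the iterates eventually
  stay in the set on which the gradient is Lipschitz.

  Comparing in each block the new exact solution with the old one yields, because the step parameter
  exceeds the Lipschitz constant,
  $f(y_{k+1}) + a \|y_{k+1} - y_k\|^2 \le f(y_k) + C \rho^{2k}$ and a subgradient of the objective at
  $y_{k+1}$ of norm at most $C (\|y_{k+1} - y_k\| + \rho^k)$ (\<open>perturbed_descent\<close>).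

  The geometric error can be absorbed.  With $s_k = \|y_{k+1} - y_k\| + \rho^k$ and
  $\psi_k = f(y_k) - f(x) + B \rho^{2k}$, where $x$ is a limit point and $B$ is large, one has
  $\psi_{k+1} + a' s_k^2 \le \psi_k$, and the Lojasiewicz inequality with exponent $\theta$ becomes
  $\psi_{k+1}^t \le C s_k$ with $t = \max(\theta, 1/2)$: the maximum appears since $\rho^{2k}$ to the
  power $t$ must be bounded by $\rho^k$.  So $y$ behaves like an unperturbed descent sequence, $\psi_k$
  stays positive because $s_k$ never vanishes, and the exponents below $1/2$ reduce to $1/2$.  The usual
  argument then shows that $s_{k-1} + D \psi_k^{1-t}$ dominates the remaining length of the path,
  which gives $\|y_{k+1} - x\| = O(\psi_k^{1-t})$, while $\psi_{k+1}^{2t} \le C (\psi_k -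
  \psi_{k+1})$ makes $\psi$ decay geometrically if $t = 1/2$ and like $k^{-1/(2t-1)}$ if $t > 1/2$
  (\<open>inexact_descent_rate\<close>).

  This is applied twice.  Limit points exist by compactness and are stationary since the
  subgradients tend to 0, so some exponent is available at each of them and the whole sequence
  converges; therefore the limit point is unique, and the exponent given there determines the rate.
\<close>

section \<open>Power inequalities and recursions for sequences\<close>

lemma powr_concave_tangent:
  fixes x y q :: real
  assumes "0 < x" "0 < y" "0 < q" "q < 1"
  shows "q * x powr (q - 1) * (x - y) \<le> x powr q - y powr q"
proof -
  have "(y / x) powr q * 1 powr (1 - q) \<le> q * (y / x) + (1 - q) * 1"
    by (rule Youngs_inequality_0) (use assms in auto)
  then have "x powr q * (y / x) powr q \<le> x powr q * (q * (y / x) + (1 - q))"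
    using assms by (intro mult_left_mono) auto
  moreover have "x powr q * (y / x) powr q = y powr q"
    using assms by (simp add: powr_divide)
  moreover have "x powr q = x powr (q - 1) * x"
    using assms by (simp add: powr_diff)
  moreover have "x powr q * (q * (y / x) + (1 - q)) = x powr q - q * x powr (q - 1) * (x - y)"
    unfolding \<open>x powr q = x powr (q - 1) * x\<close> using assms by (simp add: field_simps)
  ultimately show ?thesis by linarith
qed

lemma powr_convex_tangent:
  fixes x y q :: real
  assumes "0 < x" "0 < y" "0 < q"
  shows "q * x powr (- q - 1) * (x - y) \<le> y powr (- q) - x powr (- q)"
proof -
  have "1 - q * (y / x - 1) \<le> 1 + (- q) * ln (y / x)"
    using ln_le_minus_one[of "y / x"] assms by simp
  also have "\<dots> \<le> exp ((- q) * ln (y / x))"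
    by (rule exp_ge_add_one_self)
  also have "\<dots> = (y / x) powr (- q)"
    using assms by (simp add: powr_def)
  finally have "x powr (- q) * (1 - q * (y / x - 1)) \<le> x powr (- q) * (y / x) powr (- q)"
    using assms by (intro mult_left_mono) auto
  moreover have "x powr (- q) * (y / x) powr (- q) = y powr (- q)"
    using assms by (simp add: powr_divide)
  moreover have "x powr (- q) = x powr (- q - 1) * x"
    using assms by (simp add: powr_diff)
  moreover have "x powr (- q) * (1 - q * (y / x - 1)) = x powr (- q) + q * x powr (- q - 1) * (x - y)"
    unfolding \<open>x powr (- q) = x powr (- q - 1) * x\<close> using assms by (simp add: field_simps)
  ultimately show ?thesis by linarith
qed

text \<open>
  Solving the hypothesis for the new value gives the contraction factor \<open>C / (1 + C)\<close>.
\<close>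

lemma geometric_decay_of_difference_bound:
  fixes \<psi> :: "nat \<Rightarrow> real"
  assumes C: "0 < C" and pos: "\<And>k. K \<le> k \<Longrightarrow> 0 < \<psi> k"
    and rec: "\<And>k. K \<le> k \<Longrightarrow> \<psi> (Suc k) \<le> C * (\<psi> k - \<psi> (Suc k))"
  obtains q A where "0 < q" "q < 1" "0 < A" "\<And>k. K \<le> k \<Longrightarrow> \<psi> k \<le> A * q ^ k"
proof
  let ?q = "C / (1 + C)"
  show q: "0 < ?q" "?q < 1" using C by auto
  show "0 < \<psi> K / ?q ^ K" using pos[of K] q by simp
  show "\<psi> k \<le> \<psi> K / ?q ^ K * ?q ^ k" if "K \<le> k" for k
    using that
  proof (induction k rule: dec_induct)
    case base
    have "?q ^ K \<noteq> 0" using q C by simp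
    then show ?case by (metis nonzero_eq_divide_eq order_refl)
  next
    case (step k)
    have "\<psi> (Suc k) \<le> ?q * \<psi> k"
      using rec[of k] step C by (simp add: field_simps)
    also have "\<dots> \<le> ?q * (\<psi> K / ?q ^ K * ?q ^ k)"
      using step q by (intro mult_left_mono) auto
    finally show ?case by (simp add: field_simps)
  qed
qed

text \<open>
  The negative power \<open>\<psi> k powr (- (p - 1))\<close> grows at least linearly.  If a step does not halve \<open>\<psi>\<close>,
  convexity of that power turns the recursion into a constant increment; if it does, the power is
  multiplied by a factor greater than 1, which also adds at least a constant as the power never
  falls below its initial value.
\<close>

lemma sublinear_decay_of_difference_bound:
  fixes \<psi> :: "nat \<Rightarrow> real"
  assumes C: "0 < C" and p: "1 < p" and pos: "\<And>k. K \<le> k \<Longrightarrow> 0 < \<psi> k"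
    and rec: "\<And>k. K \<le> k \<Longrightarrow> \<psi> (Suc k) powr p \<le> C * (\<psi> k - \<psi> (Suc k))"
  obtains A where "0 < A" "\<And>k. 2 * K \<le> k \<Longrightarrow> 0 < k \<Longrightarrow> \<psi> k \<le> A * real k powr (- (1 / (p - 1)))"
proof -
  define g where "g k = \<psi> k powr (- (p - 1))" for k
  define \<mu> where "\<mu> = min ((p - 1) * 2 powr (- p) / C) ((2 powr (p - 1) - 1) * g K)"
  have gpos: "0 < g k" if "K \<le> k" for k
    using pos[OF that] by (simp add: g_def)
  have "1 < 2 powr (p - 1)" using p powr_less_mono[of 0 "p - 1" 2] by simp
  then have mu: "0 < \<mu>"
    using C p gpos[of K] by (simp add: \<mu>_def)
  have mono: "\<psi> (Suc k) \<le> \<psi> k" if "K \<le> k" for k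
  proof -
    have "0 \<le> \<psi> (Suc k) powr p" by simp
    then have "0 \<le> C * (\<psi> k - \<psi> (Suc k))" using rec[OF that] by linarith
    then show ?thesis using C by (simp add: zero_le_mult_iff)
  qed
  have inc: "g k + \<mu> \<le> g (Suc k)" if k: "K \<le> k" and gK: "g K \<le> g k" for k
  proof (cases "\<psi> k \<le> 2 * \<psi> (Suc k)")
    case True
    have "\<mu> \<le> (p - 1) * (2 powr (- p) / C)" by (simp add: \<mu>_def)
    also have "\<dots> \<le> (p - 1) * (\<psi> k powr (- p) * (\<psi> k - \<psi> (Suc k)))"
    proof (intro mult_left_mono)
      have "\<psi> k powr p \<le> (2 * \<psi> (Suc k)) powr p"
        using True pos[OF k] p by (intro powr_mono2) auto
      also have "\<dots> = 2 powr p * \<psi> (Suc k) powr p"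
        using pos[of "Suc k"] k by (simp add: powr_mult)
      also have "\<dots> \<le> 2 powr p * (C * (\<psi> k - \<psi> (Suc k)))"
        using rec[OF k] by (intro mult_left_mono) auto
      finally show "2 powr (- p) / C \<le> \<psi> k powr (- p) * (\<psi> k - \<psi> (Suc k))"
        using C pos[OF k] by (simp add: powr_minus field_simps)
    qed (use p in auto)
    also have "\<dots> \<le> g (Suc k) - g k"
      using powr_convex_tangent[of "\<psi> k" "\<psi> (Suc k)" "p - 1"] pos[OF k] pos[of "Suc k"] k p
      by (simp add: g_def mult.assoc)
    finally show ?thesis by simp
  next
    case False
    have "2 powr (p - 1) * g k = (\<psi> k / 2) powr (- (p - 1))"
      using pos[OF k] powr_minus[of 2 "p - 1"] by (simp only: g_def powr_divide) (simp add: divide_inverse)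
    also have "\<dots> \<le> g (Suc k)"
      unfolding g_def using False pos[of "Suc k"] k p by (intro powr_mono2') auto
    finally have "(2 powr (p - 1) - 1) * g k \<le> g (Suc k) - g k"
      by (simp add: algebra_simps)
    moreover have "(2 powr (p - 1) - 1) * g K \<le> (2 powr (p - 1) - 1) * g k"
      using gK \<open>1 < 2 powr (p - 1)\<close> by (intro mult_left_mono) auto
    ultimately show ?thesis by (simp add: \<mu>_def)
  qed
  have lin: "g K + \<mu> * real (k - K) \<le> g k" if "K \<le> k" for k
    using that
  proof (induction k rule: dec_induct)
    case (step k)
    have "g K \<le> g k"
      using step mu by (smt (verit) mult_nonneg_nonneg of_nat_0_le_iff)
    then have "g k + \<mu> \<le> g (Suc k)" using inc step by simp
    moreover have "real (Suc k - K) = real (k - K) + 1" using step by simp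
    ultimately show ?case using step by (simp add: algebra_simps)
  qed simp
  show thesis
  proof (rule that)
    show "0 < (\<mu> / 2) powr (- (1 / (p - 1)))" using mu by simp
    fix k :: nat
    assume k: "2 * K \<le> k" "0 < k"
    have "\<mu> / 2 * real k \<le> \<mu> * real (k - K)"
      using k mu by (simp add: of_nat_diff field_simps)
    also have "\<dots> \<le> g k" using lin[of k] gpos[of K] k by linarith
    finally have "g k powr (- (1 / (p - 1))) \<le> (\<mu> / 2 * real k) powr (- (1 / (p - 1)))"
      using mu k p by (intro powr_mono2') auto
    moreover have "g k powr (- (1 / (p - 1))) = \<psi> k"
    proof -
      have "(p - 1) * (1 / (p - 1)) = 1" using p by simp
      then show ?thesis
        using pos[of k] k unfolding g_def powr_powr minus_mult_minus by simp
    qed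
    moreover have "(\<mu> / 2 * real k) powr (- (1 / (p - 1)))
        = (\<mu> / 2) powr (- (1 / (p - 1))) * real k powr (- (1 / (p - 1)))"
      by (rule powr_mult)
    ultimately show "\<psi> k \<le> (\<mu> / 2) powr (- (1 / (p - 1))) * real k powr (- (1 / (p - 1)))"
      by simp
  qed
qed

section \<open>Descent sequences under a Lojasiewicz inequality\<close>

text \<open>
  While the sequence is near \<open>x\<close>, the potential \<open>H\<close> pays for every step.  A late member of the
  subsequence is so close to \<open>x\<close>, and its potential so small, that the sequence can never spend enough
  to leave the ball; after that the potential bounds the length of the whole remaining path.
\<close>

lemma finite_length_trap:
  fixes y :: "nat \<Rightarrow> 'a::real_normed_vector" and H :: "nat \<Rightarrow> real"
  assumes \<eta>: "0 < \<eta>" and H0: "H \<longlonglongrightarrow> 0" and Hpos: "\<And>k. K \<le> k \<Longrightarrow> 0 \<le> H k"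
    and step: "\<And>k. K \<le> k \<Longrightarrow> y k \<in> cball x \<eta> \<Longrightarrow> norm (y (Suc k) - y k) \<le> H k - H (Suc k)"
    and r: "strict_mono r" "(y \<circ> r) \<longlonglongrightarrow> x"
  shows "\<forall>\<^sub>F k in sequentially. norm (y k - x) \<le> H k"
proof -
  have "(\<lambda>j. norm (y (r j) - x) + H (r j)) \<longlonglongrightarrow> 0 + 0"
    using r(2) LIMSEQ_subseq_LIMSEQ[OF H0 r(1)]
    by (intro tendsto_add) (auto simp: o_def tendsto_norm_zero_iff LIM_zero_iff)
  then have "\<forall>\<^sub>F j in sequentially. norm (y (r j) - x) + H (r j) < \<eta>"
    using \<eta> by (auto elim: order_tendstoD)
  then obtain j where j: "norm (y (r j) - x) + H (r j) < \<eta>" "K \<le> j"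
    using eventually_happens[OF eventually_conj[OF _ eventually_ge_at_top[of K]]]
    by (metis (mono_tags, lifting) trivial_limit_sequentially)
  define k where "k = r j"
  have kK: "K \<le> k" using j(2) seq_suble[OF r(1), of j] by (simp add: k_def)
  have trap: "norm (y m - x) + H m < \<eta>" if "k \<le> m" for m
    using that
  proof (induction m rule: dec_induct)
    case (step m)
    have "y m \<in> cball x \<eta>"
      using step Hpos[of m] kK by (simp add: dist_norm norm_minus_commute)
    then have "norm (y (Suc m) - y m) \<le> H m - H (Suc m)"
      using assms(4)[of m] step kK by simp
    moreover have "norm (y (Suc m) - x) \<le> norm (y (Suc m) - y m) + norm (y m - x)"
      using norm_triangle_ineq[of "y (Suc m) - y m" "y m - x"] by simp
    ultimately show ?case using step by linarith
  qed (use j in \<open>simp add: k_def\<close>)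
  have diff: "norm (y l - y m) \<le> H m - H l" if "k \<le> m" "m \<le> l" for m l
    using that(2)
  proof (induction l rule: dec_induct)
    case (step l)
    have "k \<le> l" using step that by simp
    then have "y l \<in> cball x \<eta>"
      using trap[of l] Hpos[of l] kK by (simp add: dist_norm norm_minus_commute)
    then have "norm (y (Suc l) - y l) \<le> H l - H (Suc l)"
      using assms(4)[of l] \<open>k \<le> l\<close> kK by simp
    moreover have "norm (y (Suc l) - y m) \<le> norm (y (Suc l) - y l) + norm (y l - y m)"
      using norm_triangle_ineq[of "y (Suc l) - y l" "y l - y m"] by simp
    ultimately show ?case using step by linarith
  qed simp
  have "norm (y m - x) \<le> H m" if m: "k \<le> m" for m
  proof (rule tendsto_upperbound)
    show "(\<lambda>i. norm (y m - y (r i))) \<longlonglongrightarrow> norm (y m - x)"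
      using r(2) by (intro tendsto_intros) (simp add: o_def)
    have "norm (y m - y (r i)) \<le> H m" if "m \<le> i" for i
    proof -
      have "m \<le> r i" using that seq_suble[OF r(1), of i] by simp
      then show ?thesis
        using diff[of m "r i"] Hpos[of "r i"] m kK by (simp add: norm_minus_commute)
    qed
    then show "\<forall>\<^sub>F i in sequentially. norm (y m - y (r i)) \<le> H m"
      by (auto simp: eventually_sequentially)
  qed simp
  then show ?thesis by (auto simp: eventually_sequentially)
qed


lemma eventually_le_O_I:
  "\<forall>\<^sub>F k in sequentially. a k \<le> C * b k \<Longrightarrow> eventually_le_O a b"
  unfolding eventually_le_O_def by blast

lemma eventually_le_O_trans:
  assumes "eventually_le_O a b" "eventually_le_O b c" "\<And>k. 0 \<le> b k"
  shows "eventually_le_O a c"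
proof -
  obtain C D where C: "\<forall>\<^sub>F k in sequentially. a k \<le> C * b k"
    and D: "\<forall>\<^sub>F k in sequentially. b k \<le> D * c k"
    using assms(1,2) unfolding eventually_le_O_def by blast
  from C D have "\<forall>\<^sub>F k in sequentially. a k \<le> (max C 0 * D) * c k"
  proof eventually_elim
    case (elim k)
    have "a k \<le> max C 0 * b k"
      using elim(1) assms(3)[of k] mult_right_mono[of C "max C 0" "b k"] by linarith
    also have "\<dots> \<le> max C 0 * (D * c k)"
      using elim(2) by (intro mult_left_mono) auto
    finally show ?case by (simp add: mult.assoc)
  qed
  then show ?thesis by (rule eventually_le_O_I)
qed

lemma eventually_le_O_add:
  assumes "eventually_le_O a c" "eventually_le_O b c"
  shows "eventually_le_O (\<lambda>k. a k + b k) c"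
proof -
  obtain C D where "\<forall>\<^sub>F k in sequentially. a k \<le> C * c k"
    and "\<forall>\<^sub>F k in sequentially. b k \<le> D * c k"
    using assms unfolding eventually_le_O_def by blast
  then have "\<forall>\<^sub>F k in sequentially. a k + b k \<le> (C + D) * c k"
    by eventually_elim (simp add: algebra_simps)
  then show ?thesis by (rule eventually_le_O_I)
qed

lemma eventually_le_O_power:
  fixes a b :: real
  assumes "0 < a" "a \<le> b"
  shows "eventually_le_O (\<lambda>k. a ^ k) (\<lambda>k. b ^ k)"
  by (rule eventually_le_O_I[of _ 1]) (use assms in \<open>auto intro!: always_eventually power_mono\<close>)

text \<open>
  With \<open>s = q powr (1 / b)\<close> the claim is the boundedness of \<open>(k * s ^ k) powr b\<close>.
\<close>

lemma eventually_le_O_power_powr: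
  fixes q b :: real
  assumes q: "0 < q" "q < 1" and b: "0 < b"
  shows "eventually_le_O (\<lambda>k. q ^ k) (\<lambda>k. real k powr (- b))"
proof -
  define s where "s = q powr (1 / b)"
  have s: "0 < s" "s < 1"
    using q b powr_less_mono2[of "1 / b" q 1] by (auto simp: s_def)
  have "(\<lambda>k. real k * s ^ k) \<longlonglongrightarrow> 0"
    using powser_times_n_limit_0[of s] s by simp
  then have "(\<lambda>k. (real k * s ^ k) powr b) \<longlonglongrightarrow> 0"
    by (rule tendsto_zero_powrI[OF _ tendsto_const _ b]) (use s in simp)
  then have "\<forall>\<^sub>F k in sequentially. (real k * s ^ k) powr b < 1" by (rule order_tendstoD) simp
  then have "\<forall>\<^sub>F k in sequentially. q ^ k \<le> 1 * real k powr (- b)"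
    using eventually_gt_at_top[of 0]
  proof eventually_elim
    case (elim k)
    have "(s ^ k) powr b = q ^ k"
      using q b s by (simp add: s_def powr_powr powr_realpow[symmetric] mult.commute)
    then have "(real k * s ^ k) powr b = real k powr b * q ^ k" by (simp add: powr_mult)
    then show ?case using elim by (simp add: powr_minus field_simps)
  qed
  then show ?thesis by (rule eventually_le_O_I)
qed

text \<open>
  The constant \<open>B\<close> is chosen such that passing from \<open>B * (\<rho> ^ k)\<^sup>2\<close> to the next such term releases
  \<open>(C + a) * (\<rho> ^ k)\<^sup>2\<close>: the part with \<open>C\<close> pays for the error, and the part with \<open>a\<close> allows the
  error itself to be counted as a step.
\<close>

lemma descent_with_geometric_error:
  fixes y :: "nat \<Rightarrow> 'a::real_normed_vector" and \<phi> :: "nat \<Rightarrow> real"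
  assumes a: "0 < a" and \<rho>: "0 < \<rho>" "\<rho> < 1" and C: "0 \<le> C"
    and desc: "\<And>k. K \<le> k \<Longrightarrow> \<phi> (Suc k) + a * (norm (y (Suc k) - y k))\<^sup>2 \<le> \<phi> k + C * (\<rho> ^ k)\<^sup>2"
  obtains B where "0 < B"
    "\<And>k. K \<le> k \<Longrightarrow> (\<phi> (Suc k) + B * (\<rho> ^ Suc k)\<^sup>2) + a / 2 * (norm (y (Suc k) - y k) + \<rho> ^ k)\<^sup>2
      \<le> \<phi> k + B * (\<rho> ^ k)\<^sup>2"
proof -
  have r2: "\<rho>\<^sup>2 < 1" using \<rho> by (simp add: power_less_one_iff)
  define B where "B = (C + a) / (1 - \<rho>\<^sup>2)"
  have Bpos: "0 < B" using r2 a C by (simp add: B_def)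
  have B: "B * (1 - \<rho>\<^sup>2) = C + a" using r2 by (simp add: B_def)
  have "(\<phi> (Suc k) + B * (\<rho> ^ Suc k)\<^sup>2) + a / 2 * (norm (y (Suc k) - y k) + \<rho> ^ k)\<^sup>2
      \<le> \<phi> k + B * (\<rho> ^ k)\<^sup>2" if k: "K \<le> k" for k
  proof -
    define d e where "d = norm (y (Suc k) - y k)" and "e = \<rho> ^ k"
    have "(d + e)\<^sup>2 \<le> 2 * (d\<^sup>2 + e\<^sup>2)"
      using zero_le_power2[of "d - e"] by (simp add: power2_eq_square algebra_simps)
    then have "a / 2 * (d + e)\<^sup>2 \<le> a / 2 * (2 * (d\<^sup>2 + e\<^sup>2))"
      using a by (intro mult_left_mono) auto
    then have "a / 2 * (d + e)\<^sup>2 \<le> a * d\<^sup>2 + a * e\<^sup>2" by (simp add: algebra_simps)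
    moreover have "\<phi> (Suc k) + a * d\<^sup>2 \<le> \<phi> k + C * e\<^sup>2"
      using desc[OF k] by (simp add: d_def e_def)
    moreover have "B * (\<rho> ^ Suc k)\<^sup>2 = B * e\<^sup>2 - B * (1 - \<rho>\<^sup>2) * e\<^sup>2"
      by (simp add: e_def power_mult_distrib algebra_simps)
    then have "B * (\<rho> ^ Suc k)\<^sup>2 = B * e\<^sup>2 - C * e\<^sup>2 - a * e\<^sup>2"
      unfolding B by (simp add: algebra_simps)
    ultimately show ?thesis
      unfolding d_def[symmetric] e_def[symmetric] by linarith
  qed
  with Bpos show thesis by (rule that)
qed

text \<open>
  The squared steps are bounded by differences of consecutive terms of a convergent sequence.
\<close>

lemma steps_vanish_of_descent:
  fixes \<psi> s :: "nat \<Rightarrow> real"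
  assumes a: "0 < a" and dec: "\<And>k. K \<le> k \<Longrightarrow> \<psi> (Suc k) + a * (s k)\<^sup>2 \<le> \<psi> k"
    and lim: "convergent \<psi>"
  shows "s \<longlonglongrightarrow> 0"
proof -
  obtain l where l: "\<psi> \<longlonglongrightarrow> l" using lim by (auto simp: convergent_def)
  have "(\<lambda>k. (\<psi> k - \<psi> (Suc k)) / a) \<longlonglongrightarrow> (l - l) / a"
    using l LIMSEQ_Suc[OF l] a by (intro tendsto_intros) auto
  then have lim0: "(\<lambda>k. (\<psi> k - \<psi> (Suc k)) / a) \<longlonglongrightarrow> 0" by simp
  have "(\<lambda>k. (s k)\<^sup>2) \<longlonglongrightarrow> 0"
  proof (rule tendsto_sandwich[OF _ _ tendsto_const lim0])
    show "\<forall>\<^sub>F k in sequentially. (s k)\<^sup>2 \<le> (\<psi> k - \<psi> (Suc k)) / a"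
      using dec a by (auto simp: eventually_sequentially field_simps intro!: exI[of _ K])
  qed simp
  then show ?thesis by simp
qed

lemma decreasing_convergent_from:
  fixes \<psi> :: "nat \<Rightarrow> real"
  assumes dec: "\<And>k. K \<le> k \<Longrightarrow> \<psi> (Suc k) \<le> \<psi> k" and bd: "\<And>k. K \<le> k \<Longrightarrow> b \<le> \<psi> k"
  obtains l where "\<psi> \<longlonglongrightarrow> l" "\<And>k. K \<le> k \<Longrightarrow> l \<le> \<psi> k"
proof -
  have "decseq (\<lambda>k. \<psi> (k + K))" using dec by (intro decseq_SucI) simp
  then obtain l where l: "(\<lambda>k. \<psi> (k + K)) \<longlonglongrightarrow> l" "\<And>k. l \<le> \<psi> (k + K)"
    using decseq_convergent[of "\<lambda>k. \<psi> (k + K)" b] bd by (metis le_add2)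
  show thesis
  proof
    show "\<psi> \<longlonglongrightarrow> l" using l(1) by (rule LIMSEQ_offset)
    show "l \<le> \<psi> k" if "K \<le> k" for k using l(2)[of "k - K"] that by simp
  qed
qed

text \<open>
  Concavity of \<open>\<lambda>t. t powr (1 - \<theta>)\<close> combined with descent and the Lojasiewicz inequality gives
  \<open>(s k)\<^sup>2\<close> at most \<open>s (k - 1)\<close> times a difference of concave powers; by the inequality of the means
  \<open>2 * s k\<close> is at most the sum of these two factors.  This says that \<open>H\<close> below decreases by at least
  \<open>s k\<close> near \<open>x\<close>, so that the trap applies.  Descent alone bounds \<open>s\<close> by the square root of \<open>\<psi>\<close>,
  and \<open>\<theta> \<ge> 1 / 2\<close> makes \<open>\<psi> powr (1 - \<theta>)\<close> the dominant term of \<open>H\<close>.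
\<close>

lemma lojasiewicz_sequence_estimate:
  fixes y :: "nat \<Rightarrow> 'a::real_normed_vector" and \<psi> s :: "nat \<Rightarrow> real"
  assumes a: "0 < a" and C: "0 < C" and \<eta>: "0 < \<eta>" and \<theta>: "1 / 2 \<le> \<theta>" "\<theta> < 1"
    and dec: "\<And>k. K \<le> k \<Longrightarrow> \<psi> (Suc k) + a * (s k)\<^sup>2 \<le> \<psi> k"
    and step: "\<And>k. K \<le> k \<Longrightarrow> norm (y (Suc k) - y k) \<le> s k"
    and pos: "\<And>k. K \<le> k \<Longrightarrow> 0 < \<psi> k" and lim: "\<psi> \<longlonglongrightarrow> 0"
    and loj: "\<And>k. K \<le> k \<Longrightarrow> y (Suc k) \<in> cball x \<eta> \<Longrightarrow> \<psi> (Suc k) powr \<theta> \<le> C * s k"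
    and r: "strict_mono r" "(y \<circ> r) \<longlonglongrightarrow> x"
  obtains D where "0 < D" "\<forall>\<^sub>F k in sequentially. norm (y (Suc k) - x) \<le> D * \<psi> k powr (1 - \<theta>)"
    "\<forall>\<^sub>F k in sequentially. \<psi> (Suc k) powr (2 * \<theta>) \<le> D * (\<psi> k - \<psi> (Suc k))"
proof -
  define D where "D = C / ((1 - \<theta>) * a)"
  define H where "H k = s (k - 1) + D * \<psi> k powr (1 - \<theta>)" for k
  have D: "0 < D" using a C \<theta> by (simp add: D_def)
  have mono: "\<psi> (Suc k) \<le> \<psi> k" if "K \<le> k" for k
  proof -
    have "0 \<le> a * (s k)\<^sup>2" using a by simp
    then show ?thesis using dec[OF that] by linarith
  qed
  have s0: "s \<longlonglongrightarrow> 0"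
    using steps_vanish_of_descent[OF a, of K \<psi> s] dec lim by (auto simp: convergent_def)
  have snn: "0 \<le> s k" if "K \<le> k" for k using step[OF that] norm_ge_zero order_trans by blast
  have pow0: "(\<lambda>k. \<psi> k powr (1 - \<theta>)) \<longlonglongrightarrow> 0"
  proof (rule tendsto_zero_powrI[OF lim])
    show "\<forall>\<^sub>F k in sequentially. 0 \<le> \<psi> k"
      using pos by (auto simp: eventually_sequentially intro!: exI[of _ K] less_imp_le)
  qed (use \<theta> in auto)
  have "(\<lambda>k. s (k - 1)) \<longlonglongrightarrow> 0"
    by (rule LIMSEQ_imp_Suc) (simp add: s0)
  then have H0: "H \<longlonglongrightarrow> 0"
    unfolding H_def using tendsto_add[OF _ tendsto_mult_left[OF pow0, of D]] by fastforce
  have trap: "\<forall>\<^sub>F k in sequentially. norm (y k - x) \<le> H k"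
  proof (rule finite_length_trap[OF \<eta> H0 _ _ r, where K = "Suc K"])
    show "0 \<le> H k" if "Suc K \<le> k" for k
      using snn[of "k - 1"] that D by (simp add: H_def)
    fix k assume k: "Suc K \<le> k" and near: "y k \<in> cball x \<eta>"
    then obtain j where j: "k = Suc j" "K \<le> j" by (cases k) auto
    have K: "K \<le> k" using k by simp
    have L: "\<psi> k powr \<theta> \<le> C * s j" using loj[of j] j near by simp
    have "0 < \<psi> k powr \<theta>" using pos[OF K] by simp
    with L have "0 < C * s j" by linarith
    \<comment> \<open>the Lojasiewicz inequality rules out a zero step as long as \<open>\<psi>\<close> is positive\<close>
    then have sj: "0 < s j" using C by (simp add: zero_less_mult_iff)
    have "(1 - \<theta>) * a * (s k)\<^sup>2 / (C * s j) = (1 - \<theta>) * (1 / (C * s j) * (a * (s k)\<^sup>2))" by simp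
    also have "\<dots> \<le> (1 - \<theta>) * (\<psi> k powr (- \<theta>) * (\<psi> k - \<psi> (Suc k)))"
    proof (intro mult_left_mono mult_mono)
      show "1 / (C * s j) \<le> \<psi> k powr (- \<theta>)"
        using L sj C pos[OF K] by (simp add: powr_minus field_simps)
      show "a * (s k)\<^sup>2 \<le> \<psi> k - \<psi> (Suc k)" using dec[OF K] by simp
    qed (use \<theta> a in auto)
    also have "\<dots> \<le> \<psi> k powr (1 - \<theta>) - \<psi> (Suc k) powr (1 - \<theta>)"
      using powr_concave_tangent[of "\<psi> k" "\<psi> (Suc k)" "1 - \<theta>"] pos[OF K] pos[of "Suc k"] K \<theta>
      by (simp add: mult.assoc)
    finally have "(s k)\<^sup>2 \<le> s j * (D * (\<psi> k powr (1 - \<theta>) - \<psi> (Suc k) powr (1 - \<theta>)))"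
      using a C \<theta> sj by (simp add: D_def field_simps)
    also have "\<dots> \<le> ((s j + D * (\<psi> k powr (1 - \<theta>) - \<psi> (Suc k) powr (1 - \<theta>))) / 2)\<^sup>2"
      (is "s j * ?q \<le> _")
      using zero_le_power2[of "s j - ?q"] by (simp add: power2_eq_square field_simps)
    finally have sq: "(s k)\<^sup>2 \<le> ((s j + ?q) / 2)\<^sup>2" .
    have "\<psi> (Suc k) \<le> \<psi> k" using mono[OF K] .
    then have "\<psi> (Suc k) powr (1 - \<theta>) \<le> \<psi> k powr (1 - \<theta>)"
      using pos[of "Suc k"] K \<theta> by (intro powr_mono2) auto
    then have "0 \<le> ?q" using D by simp
    then have "s k \<le> (s j + ?q) / 2"
      using power2_le_imp_le[OF sq] sj by simp
    then show "norm (y (Suc k) - y k) \<le> H k - H (Suc k)"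
      using step[OF K] j by (simp add: H_def algebra_simps)
  qed
  define E where "E = 1 / sqrt a + D"
  define A where "A = max E (C\<^sup>2 / a)"
  have E: "0 < E" using D a by (simp add: E_def add_pos_pos)
  have small: "\<forall>\<^sub>F k in sequentially. \<psi> k < 1"
    using lim by (rule order_tendstoD) simp
  have near: "\<forall>\<^sub>F k in sequentially. H k < \<eta>"
    using H0 \<eta> by (rule order_tendstoD)
  have ge: "\<forall>\<^sub>F k in sequentially. K \<le> k" by (rule eventually_ge_at_top)
  have dist: "\<forall>\<^sub>F k in sequentially. norm (y (Suc k) - x) \<le> A * \<psi> k powr (1 - \<theta>)"
    using eventually_sequentially_Suc[THEN iffD2, OF trap] small ge
  proof eventually_elim
    case (elim k)
    have p: "0 < \<psi> k" using pos elim by simp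
    have "a * (s k)\<^sup>2 \<le> \<psi> k" using dec[of k] pos[of "Suc k"] elim by simp
    then have "(s k)\<^sup>2 \<le> \<psi> k / a" using a by (simp add: field_simps)
    then have "s k \<le> sqrt (\<psi> k / a)" by (rule real_le_rsqrt)
    also have "\<dots> = 1 / sqrt a * \<psi> k powr (1 / 2)"
      using p by (simp add: real_sqrt_divide powr_half_sqrt)
    also have "\<dots> \<le> 1 / sqrt a * \<psi> k powr (1 - \<theta>)"
      using p elim a \<theta> by (intro mult_left_mono powr_mono') auto
    finally have "s k \<le> 1 / sqrt a * \<psi> k powr (1 - \<theta>)" .
    moreover have "\<psi> (Suc k) \<le> \<psi> k" using mono elim by simp
    then have "D * \<psi> (Suc k) powr (1 - \<theta>) \<le> D * \<psi> k powr (1 - \<theta>)"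
      using D \<theta> pos[of "Suc k"] elim by (intro mult_left_mono powr_mono2) auto
    ultimately have "norm (y (Suc k) - x) \<le> E * \<psi> k powr (1 - \<theta>)"
      using elim(1) by (simp add: H_def E_def algebra_simps)
    also have "\<dots> \<le> A * \<psi> k powr (1 - \<theta>)"
      by (intro mult_right_mono) (auto simp: A_def)
    finally show ?case .
  qed
  have diff: "\<forall>\<^sub>F k in sequentially. \<psi> (Suc k) powr (2 * \<theta>) \<le> A * (\<psi> k - \<psi> (Suc k))"
    using eventually_sequentially_Suc[THEN iffD2, OF eventually_conj[OF trap near]] ge
  proof eventually_elim
    case (elim k)
    have "y (Suc k) \<in> cball x \<eta>"
      using elim by (simp add: dist_norm norm_minus_commute)
    then have "\<psi> (Suc k) powr \<theta> \<le> C * s k" using loj elim by simp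
    then have "(\<psi> (Suc k) powr \<theta>)\<^sup>2 \<le> (C * s k)\<^sup>2" by (intro power_mono) auto
    also have "\<dots> = C\<^sup>2 / a * (a * (s k)\<^sup>2)" using a by (simp add: power_mult_distrib)
    also have "\<dots> \<le> C\<^sup>2 / a * (\<psi> k - \<psi> (Suc k))"
      using dec[of k] elim a by (intro mult_left_mono) auto
    also have "\<dots> \<le> A * (\<psi> k - \<psi> (Suc k))"
      using mono[of k] elim by (intro mult_right_mono) (auto simp: A_def)
    finally show ?case
      using pos[of "Suc k"] elim by (simp add: power2_eq_square powr_add[symmetric])
  qed
  show thesis using that[OF _ dist diff] E by (simp add: A_def less_max_iff_disj)
qed

lemma powr_add_le:
  fixes x b t :: real
  assumes "0 \<le> x" "0 \<le> b" "0 \<le> t" "t \<le> 1"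
  shows "(x + b) powr t \<le> 2 * (x powr t + b powr t)"
proof -
  have "(x + b) powr t \<le> (2 * max x b) powr t"
    using assms by (intro powr_mono2) auto
  also have "\<dots> = 2 powr t * max x b powr t" using assms by (simp add: powr_mult)
  also have "\<dots> \<le> 2 * (x powr t + b powr t)"
  proof (intro mult_mono)
    show "2 powr t \<le> (2::real)" using powr_mono[of t 1 2] assms by simp
    show "max x b powr t \<le> x powr t + b powr t" by (simp add: max_def)
  qed auto
  finally show ?thesis .
qed

lemma eventually_le_O_Suc_geometric:
  fixes a :: "nat \<Rightarrow> real"
  assumes q: "0 < q" and a: "eventually_le_O (\<lambda>k. a (Suc k)) (\<lambda>k. q ^ k)"
  shows "eventually_le_O a (\<lambda>k. q ^ k)"
proof -
  obtain C where "\<forall>\<^sub>F k in sequentially. a (Suc k) \<le> C * q ^ k"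
    using a unfolding eventually_le_O_def by blast
  then have "\<forall>\<^sub>F k in sequentially. a (Suc k) \<le> (C / q) * q ^ Suc k"
    using q by simp
  then have "\<forall>\<^sub>F k in sequentially. a k \<le> (C / q) * q ^ k"
    by (subst (asm) eventually_sequentially_Suc)
  then show ?thesis by (rule eventually_le_O_I)
qed

lemma eventually_le_O_Suc_powr:
  fixes a :: "nat \<Rightarrow> real"
  assumes p: "0 \<le> p" and a: "eventually_le_O (\<lambda>k. a (Suc k)) (\<lambda>k. real k powr (- p))"
  shows "eventually_le_O a (\<lambda>k. real k powr (- p))"
proof -
  obtain C where "\<forall>\<^sub>F k in sequentially. a (Suc k) \<le> C * real k powr (- p)"
    using a unfolding eventually_le_O_def by blast
  then have "\<forall>\<^sub>F k in sequentially. a (Suc k) \<le> (max C 0 * 2 powr p) * real (Suc k) powr (- p)"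
    using eventually_ge_at_top[of 1]
  proof eventually_elim
    case (elim k)
    have "a (Suc k) \<le> max C 0 * real k powr (- p)"
      using elim(1) mult_right_mono[of C "max C 0" "real k powr (- p)"] by simp
    also have "real k powr (- p) \<le> (real (Suc k) / 2) powr (- p)"
      using elim p by (intro powr_mono2') auto
    also have "\<dots> = real (Suc k) powr (- p) / 2 powr (- p)" by (rule powr_divide)
    also have "\<dots> = 2 powr p * real (Suc k) powr (- p)"
      unfolding powr_minus[of 2 p] by (simp only: divide_inverse inverse_inverse_eq mult.commute)
    finally show ?case by (simp add: mult_left_mono mult.assoc)
  qed
  then have "\<forall>\<^sub>F k in sequentially. a k \<le> (max C 0 * 2 powr p) * real k powr (- p)"
    by (subst (asm) eventually_sequentially_Suc)
  then show ?thesis by (rule eventually_le_O_I)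
qed

text \<open>
  The error is absorbed into \<open>\<psi>\<close> and \<open>s\<close>, which then satisfy the hypotheses of the unperturbed
  estimate with the exponent \<open>t = max \<theta> (1 / 2)\<close>.  Raising the exponent is harmless near \<open>x\<close>, where the
  values differ from the limit value by less than 1.
\<close>

theorem inexact_descent_rate:
  fixes y :: "nat \<Rightarrow> 'a::real_normed_vector" and \<phi> :: "nat \<Rightarrow> real"
  assumes a: "0 < a" and \<rho>: "0 < \<rho>" "\<rho> < 1" and C: "0 \<le> C" and \<eta>: "0 < \<eta>" and \<theta>: "0 \<le> \<theta>" "\<theta> < 1"
    and desc: "\<And>k. K \<le> k \<Longrightarrow> \<phi> (Suc k) + a * (norm (y (Suc k) - y k))\<^sup>2 \<le> \<phi> k + C * (\<rho> ^ k)\<^sup>2"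
    and loj: "\<And>k. K \<le> k \<Longrightarrow> y (Suc k) \<in> cball x \<eta> \<Longrightarrow>
      \<bar>\<phi> (Suc k) - \<phi>x\<bar> powr \<theta> \<le> C * (norm (y (Suc k) - y k) + \<rho> ^ k)"
    and r: "strict_mono r" "(y \<circ> r) \<longlonglongrightarrow> x" "(\<phi> \<circ> r) \<longlonglongrightarrow> \<phi>x"
  shows "y \<longlonglongrightarrow> x"
    and "\<theta> \<le> 1 / 2 \<Longrightarrow> \<exists>q. 0 < q \<and> q < 1 \<and> eventually_le_O (\<lambda>k. norm (y k - x)) (\<lambda>k. q ^ k)"
    and "1 / 2 < \<theta> \<Longrightarrow>
      eventually_le_O (\<lambda>k. norm (y k - x)) (\<lambda>k. real k powr (- ((1 - \<theta>) / (2 * \<theta> - 1))))"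
proof -
  obtain B where B: "0 < B" "\<And>k. K \<le> k \<Longrightarrow>
      (\<phi> (Suc k) + B * (\<rho> ^ Suc k)\<^sup>2) + a / 2 * (norm (y (Suc k) - y k) + \<rho> ^ k)\<^sup>2
      \<le> \<phi> k + B * (\<rho> ^ k)\<^sup>2"
    using descent_with_geometric_error[OF a \<rho> C desc] by blast
  define \<psi> where "\<psi> k = \<phi> k - \<phi>x + B * (\<rho> ^ k)\<^sup>2" for k
  define s where "s k = norm (y (Suc k) - y k) + \<rho> ^ k" for k
  have dec: "\<psi> (Suc k) + a / 2 * (s k)\<^sup>2 \<le> \<psi> k" if "K \<le> k" for k
    using B(2)[OF that] by (simp add: \<psi>_def s_def)
  have spos: "0 < s k" for k using \<rho> by (simp add: s_def add_nonneg_pos)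
  have mono: "\<psi> (Suc k) \<le> \<psi> k" if "K \<le> k" for k
  proof -
    have "0 \<le> a / 2 * (s k)\<^sup>2" using a by simp
    then show ?thesis using dec[OF that] by linarith
  qed
  have mono': "\<psi> l \<le> \<psi> k" if "K \<le> k" "k \<le> l" for k l
    using that(2) by (induction l rule: dec_induct) (use mono that in \<open>auto intro: order_trans\<close>)
  have err: "(\<lambda>k. B * (\<rho> ^ k)\<^sup>2) \<longlonglongrightarrow> 0"
    using tendsto_mult[OF tendsto_const[of B] tendsto_power[OF LIMSEQ_realpow_zero[of \<rho>], of 2]] \<rho> by simp
  have sub: "(\<lambda>i. \<psi> (r i)) \<longlonglongrightarrow> 0"
    using tendsto_add[OF tendsto_diff[OF r(3) tendsto_const[of \<phi>x]] LIMSEQ_subseq_LIMSEQ[OF err r(1)]]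
    by (simp add: \<psi>_def o_def)
  have nn: "0 \<le> \<psi> k" if "K \<le> k" for k
  proof (rule tendsto_upperbound[OF sub])
    have "\<psi> (r i) \<le> \<psi> k" if "k \<le> i" for i
      using mono'[OF \<open>K \<le> k\<close>, of "r i"] seq_suble[OF r(1), of i] that by simp
    then show "\<forall>\<^sub>F i in sequentially. \<psi> (r i) \<le> \<psi> k" by (auto simp: eventually_sequentially)
  qed simp
  have lim: "\<psi> \<longlonglongrightarrow> 0"
  proof -
    obtain l where l: "\<psi> \<longlonglongrightarrow> l" using decreasing_convergent_from[of K \<psi> 0, OF mono nn] .
    then have "(\<lambda>i. \<psi> (r i)) \<longlonglongrightarrow> l" using LIMSEQ_subseq_LIMSEQ[OF l r(1)] by (simp add: o_def)
    then have "l = 0" using sub LIMSEQ_unique by blast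
    with l show ?thesis by simp
  qed
  have pos: "0 < \<psi> k" if "K \<le> k" for k
  proof -
    have "0 < a / 2 * (s k)\<^sup>2" using a spos[of k] by simp
    then show ?thesis using dec[OF that] nn[of "Suc k"] that by simp
  qed
  define t where "t = max \<theta> (1 / 2)"
  have t: "1 / 2 \<le> t" "t < 1" "\<theta> \<le> t" using \<theta> by (auto simp: t_def)
  have "(\<lambda>k. \<psi> k - B * (\<rho> ^ k)\<^sup>2) \<longlonglongrightarrow> 0 - 0" using lim err by (rule tendsto_diff)
  then have "(\<lambda>k. \<bar>\<phi> k - \<phi>x\<bar>) \<longlonglongrightarrow> 0" by (simp add: \<psi>_def tendsto_rabs_zero_iff)
  then have "\<forall>\<^sub>F k in sequentially. \<bar>\<phi> k - \<phi>x\<bar> < 1" by (rule order_tendstoD) simp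
  then obtain K1 where K1: "\<And>k. K1 \<le> k \<Longrightarrow> \<bar>\<phi> k - \<phi>x\<bar> < 1" by (auto simp: eventually_sequentially)
  define K2 where "K2 = max K K1"
  have loj': "\<psi> (Suc k) powr t \<le> 2 * (C + B powr t) * s k"
    if k: "K2 \<le> k" and near: "y (Suc k) \<in> cball x \<eta>" for k
  proof -
    have kK: "K \<le> k" "K1 \<le> Suc k" using k by (auto simp: K2_def)
    define d where "d = \<bar>\<phi> (Suc k) - \<phi>x\<bar>"
    have d: "0 \<le> d" "d < 1" using K1[OF kK(2)] by (auto simp: d_def)
    have rk: "0 < \<rho> ^ k" "\<rho> ^ k \<le> 1" using \<rho> by (auto simp: power_le_one)
    have "(\<rho> ^ Suc k)\<^sup>2 \<le> (\<rho> ^ k)\<^sup>2"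
      using \<rho> rk by (intro power_mono) (auto simp: mult_left_le_one_le)
    then have "B * (\<rho> ^ Suc k)\<^sup>2 \<le> B * (\<rho> ^ k)\<^sup>2" using B by (intro mult_left_mono) auto
    then have "\<psi> (Suc k) \<le> d + B * (\<rho> ^ k)\<^sup>2" unfolding \<psi>_def d_def by linarith
    then have "\<psi> (Suc k) powr t \<le> (d + B * (\<rho> ^ k)\<^sup>2) powr t"
      using pos[of "Suc k"] kK t by (intro powr_mono2) auto
    also have "\<dots> \<le> 2 * (d powr t + (B * (\<rho> ^ k)\<^sup>2) powr t)"
      using d B t by (intro powr_add_le) auto
    also have "\<dots> \<le> 2 * (C * s k + B powr t * s k)"
    proof (intro mult_left_mono add_mono)
      \<comment> \<open>if \<open>d = 0\<close>, both sides are 0, even for \<open>\<theta> = 0\<close>, by the convention for powers of 0\<close>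
      have "d powr t \<le> d powr \<theta>"
        using d t by (cases "d = 0") (auto intro: powr_mono')
      also have "\<dots> \<le> C * s k" using loj[OF kK(1) near] by (simp add: d_def s_def)
      finally show "d powr t \<le> C * s k" .
      \<comment> \<open>this is where \<open>t \<ge> 1 / 2\<close> is needed\<close>
      have "((\<rho> ^ k)\<^sup>2) powr t = (\<rho> ^ k) powr (2 * t)"
        using rk by (simp add: power2_eq_square powr_mult powr_add[symmetric])
      also have "\<dots> \<le> (\<rho> ^ k) powr 1" using rk t by (intro powr_mono') auto
      also have "\<dots> \<le> s k" using rk by (simp add: s_def)
      finally have "((\<rho> ^ k)\<^sup>2) powr t \<le> s k" .
      then have "B powr t * ((\<rho> ^ k)\<^sup>2) powr t \<le> B powr t * s k" by (intro mult_left_mono) auto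
      then show "(B * (\<rho> ^ k)\<^sup>2) powr t \<le> B powr t * s k" using B by (simp add: powr_mult)
    qed simp
    finally show ?thesis by (simp add: algebra_simps)
  qed
  have C2: "0 < 2 * (C + B powr t)" using C B by (simp add: add_nonneg_pos)
  obtain D where D: "0 < D"
    "\<forall>\<^sub>F k in sequentially. norm (y (Suc k) - x) \<le> D * \<psi> k powr (1 - t)"
    "\<forall>\<^sub>F k in sequentially. \<psi> (Suc k) powr (2 * t) \<le> D * (\<psi> k - \<psi> (Suc k))"
  proof (rule lojasiewicz_sequence_estimate[of "a / 2" "2 * (C + B powr t)" \<eta> t K2 \<psi> s y x r])
    show "norm (y (Suc k) - y k) \<le> s k" for k using \<rho> by (simp add: s_def)
    show "2 * (C + B powr t) > 0" by (fact C2)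
    show "\<psi> (Suc k) powr t \<le> 2 * (C + B powr t) * s k"
      if "K2 \<le> k" "y (Suc k) \<in> cball x \<eta>" for k using loj' that by simp
  qed (use a \<eta> t dec pos lim r K2_def in auto)
  have "(\<lambda>k. D * \<psi> k powr (1 - t)) \<longlonglongrightarrow> D * 0"
  proof (intro tendsto_mult_left tendsto_zero_powrI[OF lim])
    show "\<forall>\<^sub>F k in sequentially. 0 \<le> \<psi> k" using nn by (auto simp: eventually_sequentially)
  qed (use t in auto)
  then have "(\<lambda>k. D * \<psi> k powr (1 - t)) \<longlonglongrightarrow> 0" by simp
  with D(2) have "(\<lambda>k. y (Suc k) - x) \<longlonglongrightarrow> 0" by (rule Lim_null_comparison)
  then have "(\<lambda>k. y (Suc k)) \<longlonglongrightarrow> x" by (simp add: LIM_zero_iff)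
  then show "y \<longlonglongrightarrow> x" by (rule LIMSEQ_imp_Suc)
  obtain K3 where K3: "\<And>k. K3 \<le> k \<Longrightarrow> \<psi> (Suc k) powr (2 * t) \<le> D * (\<psi> k - \<psi> (Suc k))"
    using D(3) by (auto simp: eventually_sequentially)
  define K4 where "K4 = max K K3"
  have rec: "0 < \<psi> k" "\<psi> (Suc k) powr (2 * t) \<le> D * (\<psi> k - \<psi> (Suc k))" if "K4 \<le> k" for k
    using pos K3 that by (auto simp: K4_def)
  show "\<exists>q. 0 < q \<and> q < 1 \<and> eventually_le_O (\<lambda>k. norm (y k - x)) (\<lambda>k. q ^ k)" if "\<theta> \<le> 1 / 2"
  proof -
    have th: "t = 1 / 2" using that by (simp add: t_def)
    obtain q A where q: "0 < q" "q < 1" "0 < A" "\<And>k. K4 \<le> k \<Longrightarrow> \<psi> k \<le> A * q ^ k"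
    proof (rule geometric_decay_of_difference_bound[OF D(1), of K4 \<psi>])
      show "\<psi> (Suc k) \<le> D * (\<psi> k - \<psi> (Suc k))" if "K4 \<le> k" for k
        using rec[of k] rec(1)[of "Suc k"] that th by simp
    qed (use rec in auto)
    have "\<forall>\<^sub>F k in sequentially. norm (y (Suc k) - x) \<le> (D * sqrt A) * sqrt q ^ k"
      using D(2) eventually_ge_at_top[of K4]
    proof eventually_elim
      case (elim k)
      have "\<psi> k powr (1 - t) = sqrt (\<psi> k)"
        using rec(1)[OF elim(2)] unfolding th by (simp add: powr_half_sqrt)
      also have "\<dots> \<le> sqrt (A * q ^ k)" using q(4)[OF elim(2)] by simp
      finally have "D * \<psi> k powr (1 - t) \<le> D * (sqrt A * sqrt q ^ k)"
        using D(1) by (intro mult_left_mono) (auto simp: real_sqrt_mult real_sqrt_power)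
      then show ?case using elim(1) by simp
    qed
    then have "eventually_le_O (\<lambda>k. norm (y k - x)) (\<lambda>k. sqrt q ^ k)"
      using q by (intro eventually_le_O_Suc_geometric[OF _ eventually_le_O_I]) auto
    then show ?thesis using q by (intro exI[of _ "sqrt q"]) auto
  qed
  show "eventually_le_O (\<lambda>k. norm (y k - x)) (\<lambda>k. real k powr (- ((1 - \<theta>) / (2 * \<theta> - 1))))"
    if "1 / 2 < \<theta>"
  proof -
    have th: "t = \<theta>" "1 < 2 * t" using that by (auto simp: t_def)
    obtain A where A: "0 < A"
      "\<And>k. 2 * K4 \<le> k \<Longrightarrow> 0 < k \<Longrightarrow> \<psi> k \<le> A * real k powr (- (1 / (2 * t - 1)))"
      using sublinear_decay_of_difference_bound[OF D(1) th(2), of K4 \<psi>] rec by blast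
    have "\<forall>\<^sub>F k in sequentially. norm (y (Suc k) - x)
        \<le> (D * A powr (1 - t)) * real k powr (- ((1 - \<theta>) / (2 * \<theta> - 1)))"
      using D(2) eventually_ge_at_top[of "2 * K4"] eventually_gt_at_top[of 0]
    proof eventually_elim
      case (elim k)
      have "\<psi> k powr (1 - t) \<le> (A * real k powr (- (1 / (2 * t - 1)))) powr (1 - t)"
        using A(2)[of k] elim t rec(1)[of k] by (intro powr_mono2) auto
      also have "\<dots> = A powr (1 - t) * real k powr (- ((1 - \<theta>) / (2 * \<theta> - 1)))"
        using A(1) th(1) by (simp add: powr_mult powr_powr)
      finally have "D * \<psi> k powr (1 - t)
          \<le> D * (A powr (1 - t) * real k powr (- ((1 - \<theta>) / (2 * \<theta> - 1))))"
        using D(1) by (intro mult_left_mono) auto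
      then show ?case using elim(1) by simp
    qed
    then show ?thesis
      using that \<theta> by (intro eventually_le_O_Suc_powr[OF _ eventually_le_O_I]) auto
  qed
qed

section \<open>Gradients, projections and error bounds\<close>

text \<open>
  Both derivatives must agree along the line through \<open>x\<close> with direction \<open>u - v\<close>, which stays in \<open>V\<close>.
\<close>

lemma grad_on_unique:
  fixes V :: "'a::euclidean_space set"
  assumes V: "subspace V" and x: "x \<in> V" and u: "u \<in> V" "v \<in> V"
    and du: "(g has_derivative (\<lambda>d. u \<bullet> d)) (at x within V)"
    and dv: "(g has_derivative (\<lambda>d. v \<bullet> d)) (at x within V)"
  shows "u = v"
proof -
  define w where "w = u - v"
  have w: "w \<in> V" using V u by (simp add: w_def subspace_diff)
  have maps: "(\<lambda>t. x + t *\<^sub>R w) ` UNIV \<subseteq> V"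
    using V x w by (auto intro: subspace_add subspace_scale)
  have line: "((\<lambda>t. x + t *\<^sub>R w) has_derivative (\<lambda>t. t *\<^sub>R w)) (at (0::real))"
    by (auto intro!: derivative_eq_intros)
  have "((\<lambda>t. g (x + t *\<^sub>R w)) has_derivative (\<lambda>t. u \<bullet> (t *\<^sub>R w))) (at 0)"
    using has_derivative_in_compose[OF line, of g "\<lambda>d. u \<bullet> d"] has_derivative_subset[OF du maps] by simp
  moreover have "((\<lambda>t. g (x + t *\<^sub>R w)) has_derivative (\<lambda>t. v \<bullet> (t *\<^sub>R w))) (at 0)"
    using has_derivative_in_compose[OF line, of g "\<lambda>d. v \<bullet> d"] has_derivative_subset[OF dv maps] by simp
  ultimately have "(\<lambda>t::real. u \<bullet> (t *\<^sub>R w)) = (\<lambda>t. v \<bullet> (t *\<^sub>R w))"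
    by (rule has_derivative_unique)
  from fun_cong[OF this, of 1] have "w \<bullet> w = 0" by (simp add: w_def inner_diff_left)
  then show ?thesis by (simp add: w_def)
qed

lemma grad_on_eqI:
  fixes V :: "'a::euclidean_space set"
  assumes "subspace V" "x \<in> V" "u \<in> V" "(g has_derivative (\<lambda>d. u \<bullet> d)) (at x within V)"
  shows "grad_on V g x = u"
  unfolding grad_on_def using assms grad_on_unique[OF assms(1,2)] by (intro the_equality) blast+

text \<open>
  The derivative is represented by some vector of the whole space; its component orthogonal to \<open>V\<close>
  is invisible to the differences of points of \<open>V\<close>, so the component in \<open>V\<close> is the gradient.
\<close>

lemma grad_on_derivative:
  fixes V :: "'a::euclidean_space set" and g :: "'a \<Rightarrow> real"
  assumes V: "subspace V" and x: "x \<in> V" and g: "g differentiable (at x within V)"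
  shows "grad_on V g x \<in> V" and "(g has_derivative (\<lambda>d. grad_on V g x \<bullet> d)) (at x within V)"
proof -
  obtain D where D: "(g has_derivative D) (at x within V)" using g by (auto simp: differentiable_def)
  interpret D: bounded_linear D using D by (rule has_derivative_bounded_linear)
  define c where "c = (\<Sum>b\<in>Basis. D b *\<^sub>R b)"
  have c: "D d = c \<bullet> d" for d
  proof -
    have "D d = D (\<Sum>b\<in>Basis. (d \<bullet> b) *\<^sub>R b)" by (simp add: euclidean_representation)
    also have "\<dots> = (\<Sum>b\<in>Basis. (d \<bullet> b) * D b)" by (simp add: D.sum D.scaleR)
    also have "\<dots> = c \<bullet> d" by (simp add: c_def inner_sum_left inner_commute[of d] mult.commute)
    finally show ?thesis .
  qed
  obtain u w where u: "u \<in> V" "c = u + w" "\<And>d. d \<in> V \<Longrightarrow> orthogonal w d"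
  proof -
    have "\<exists>y\<in>span V. \<exists>z. c = y + z \<and> (\<forall>d\<in>span V. orthogonal z d)"
      using orthogonal_subspace_decomp_exists[of V c] by metis
    then show ?thesis using that V by (metis span_eq_iff)
  qed
  have "(g has_derivative (\<lambda>d. u \<bullet> d)) (at x within V)"
  proof -
    have eq: "D (y - x) = u \<bullet> (y - x)" if "y \<in> V" for y
      using c u(2) u(3)[of "y - x"] subspace_diff[OF V that x] by (simp add: inner_add_left orthogonal_def)
    show ?thesis
      unfolding has_derivative_within
    proof (intro conjI)
      show "bounded_linear (\<lambda>d. u \<bullet> d)" by (rule bounded_linear_inner_right)
      have "((\<lambda>y. (1 / norm (y - x)) *\<^sub>R (g y - (g x + D (y - x)))) \<longlongrightarrow> 0) (at x within V)"
        using D unfolding has_derivative_within by blast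
      then show "((\<lambda>y. (1 / norm (y - x)) *\<^sub>R (g y - (g x + u \<bullet> (y - x)))) \<longlongrightarrow> 0) (at x within V)"
        by (rule Lim_transform_eventually) (auto simp: eventually_at_filter eq)
    qed
  qed
  moreover from this have "grad_on V g x = u" using V x u(1) by (intro grad_on_eqI)
  ultimately show "grad_on V g x \<in> V" "(g has_derivative (\<lambda>d. grad_on V g x \<bullet> d)) (at x within V)"
    using u(1) by auto
qed

lemma convex_on_above_gradient:
  fixes V :: "'a::euclidean_space set" and g :: "'a \<Rightarrow> real"
  assumes V: "subspace V" and x: "x \<in> V" and w: "w \<in> V"
    and cvx: "convex_on V g" and g: "g differentiable (at x within V)"
  shows "g x + grad_on V g x \<bullet> (w - x) \<le> g w"
proof -
  let ?c = "\<lambda>t::real. g (x + t *\<^sub>R (w - x))"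
  have wx: "w - x \<in> V" using V x w by (simp add: subspace_diff)
  have maps: "(\<lambda>t. x + t *\<^sub>R (w - x)) ` UNIV \<subseteq> V"
    using V x wx by (auto intro: subspace_add subspace_scale)
  have line: "((\<lambda>t. x + t *\<^sub>R (w - x)) has_derivative (\<lambda>t. t *\<^sub>R (w - x))) (at (0::real))"
    by (auto intro!: derivative_eq_intros)
  have "(?c has_derivative (\<lambda>t. grad_on V g x \<bullet> (t *\<^sub>R (w - x)))) (at 0)"
    using has_derivative_in_compose[OF line, of g "\<lambda>d. grad_on V g x \<bullet> d"]
      has_derivative_subset[OF grad_on_derivative(2)[OF V x g] maps] by simp
  then have "(?c has_real_derivative grad_on V g x \<bullet> (w - x)) (at 0)"
    by (simp add: has_field_derivative_def mult.commute[of _ "grad_on V g x \<bullet> (w - x)"])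
  then have "(?c has_real_derivative grad_on V g x \<bullet> (w - x)) (at 0 within {0<..})"
    by (rule has_field_derivative_at_within)
  then have lim: "((\<lambda>t. (?c t - ?c 0) / (t - 0)) \<longlongrightarrow> grad_on V g x \<bullet> (w - x)) (at_right 0)"
    unfolding has_field_derivative_iff .
  have "grad_on V g x \<bullet> (w - x) \<le> g w - g x"
  proof (rule tendsto_upperbound[OF lim])
    have "(?c t - ?c 0) / (t - 0) \<le> g w - g x" if "0 < t" "t < 1" for t
    proof -
      have "g ((1 - t) *\<^sub>R x + t *\<^sub>R w) \<le> (1 - t) * g x + t * g w"
        using cvx that x w by (intro convex_onD) auto
      moreover have "(1 - t) *\<^sub>R x + t *\<^sub>R w = x + t *\<^sub>R (w - x)" by (simp add: algebra_simps)
      ultimately have "?c t - ?c 0 \<le> t * (g w - g x)" by (simp add: algebra_simps)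
      then show ?thesis using that by (simp add: divide_le_eq mult.commute)
    qed
    then show "\<forall>\<^sub>F t in at_right 0. (?c t - ?c 0) / (t - 0) \<le> g w - g x"
      by (auto simp: eventually_at_right_field intro!: exI[of _ 1])
  qed simp
  then show ?thesis by simp
qed

text \<open>
  A far point \<open>x\<close> is pulled towards its projection \<open>q\<close> until its distance is \<open>\<delta>\<close>.  On the segment the
  distance to \<open>S\<close> is proportional to the distance to \<open>q\<close>, whereas the constraint violation is convex
  and vanishes at \<open>q\<close>, so it shrinks at least proportionally.  Scaling back the bound at the nearer point
  gives the bound at \<open>x\<close> with the same constant.
\<close>

lemma error_bound_extends:
  fixes S V :: "'a::euclidean_space set" and h :: "'l \<Rightarrow> 'a \<Rightarrow> real"
  assumes V: "subspace V" and I: "finite I" and cvx: "\<And>l. l \<in> I \<Longrightarrow> convex_on V (h l)"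
    and S: "S = {w \<in> V. \<forall>l\<in>I. h l w \<le> 0}" and S_closed: "closed S" and S_convex: "convex S" and S_ne: "S \<noteq> {}"
    and \<delta>: "0 < \<delta>" and c: "0 \<le> c"
    and near: "\<And>w. w \<in> V \<Longrightarrow> infdist w S \<le> \<delta> \<Longrightarrow> infdist w S \<le> c * L2_set (\<lambda>l. max (h l w) 0) I"
    and x: "x \<in> V"
  shows "infdist x S \<le> c * L2_set (\<lambda>l. max (h l x) 0) I"
proof (cases "infdist x S \<le> \<delta>")
  case True
  then show ?thesis using near x by blast
next
  case False
  define d where "d = infdist x S"
  have d: "\<delta> < d" using False by (simp add: d_def)
  obtain q where q: "q \<in> S" "d = dist x q"
    using infdist_attains_inf[OF S_closed S_ne, of x] by (auto simp: d_def)
  define t where "t = \<delta> / d"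
  have t: "0 < t" "t < 1" using \<delta> d by (auto simp: t_def)
  define w where "w = q + t *\<^sub>R (x - q)"
  have qV: "q \<in> V" using q S by simp
  have wV: "w \<in> V"
    unfolding w_def using V qV x by (intro subspace_add subspace_scale subspace_diff)
  have nxq: "norm (x - q) = d" using q(2) by (simp add: dist_norm)
  have "infdist w S \<le> dist w q" using q(1) by (rule infdist_le)
  also have "dist w q = t * d" using nxq t by (simp add: w_def dist_norm)
  finally have "infdist w S \<le> t * d" .
  moreover have "d \<le> infdist w S + dist x w" unfolding d_def by (metis infdist_triangle)
  moreover have "dist x w = (1 - t) * d"
  proof -
    have "x - w = (1 - t) *\<^sub>R (x - q)" by (simp add: w_def algebra_simps)
    then show ?thesis using t nxq by (simp add: dist_norm)
  qed
  ultimately have iw: "infdist w S = t * d" by (simp add: algebra_simps)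
  have td: "t * d = \<delta>" using d \<delta> by (simp add: t_def)
  have "max (h l w) 0 \<le> t * max (h l x) 0" if l: "l \<in> I" for l
  proof -
    have "h l ((1 - t) *\<^sub>R q + t *\<^sub>R x) \<le> (1 - t) * h l q + t * h l x"
      using cvx[OF l] t qV x by (intro convex_onD) auto
    moreover have "(1 - t) *\<^sub>R q + t *\<^sub>R x = w" by (simp add: w_def algebra_simps)
    moreover have "(1 - t) * h l q \<le> 0" using q S l t by (simp add: mult_nonneg_nonpos)
    ultimately have "h l w \<le> t * h l x" by simp
    also have "\<dots> \<le> t * max (h l x) 0" using t by (intro mult_left_mono) auto
    finally show ?thesis using t by simp
  qed
  then have "L2_set (\<lambda>l. max (h l w) 0) I \<le> L2_set (\<lambda>l. t * max (h l x) 0) I"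
    by (intro L2_set_mono) auto
  also have "\<dots> = t * L2_set (\<lambda>l. max (h l x) 0) I"
    using t by (simp add: L2_set_right_distrib)
  finally have "c * L2_set (\<lambda>l. max (h l w) 0) I \<le> c * (t * L2_set (\<lambda>l. max (h l x) 0) I)"
    using c by (intro mult_left_mono)
  moreover have "t * d \<le> c * L2_set (\<lambda>l. max (h l w) 0) I"
    using near[OF wV] iw td by simp
  ultimately have "t * d \<le> t * (c * L2_set (\<lambda>l. max (h l x) 0) I)" by (simp add: mult.left_commute)
  then show ?thesis using t by (simp add: d_def)
qed

text \<open>
  Completing the square shows that minimizing the quadratic model means projecting the gradient step
  \<open>a - (1 / s) *\<^sub>R g\<close> onto \<open>S\<close>; the second claim is the variational inequality of the projection.
\<close>

lemma quadratic_model_minimizer: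
  fixes S :: "'a::euclidean_space set" and g a :: 'a
  assumes S: "compact S" "convex S" "S \<noteq> {}" and s: "0 < s"
    and b: "b = arg_min_on (\<lambda>x. g \<bullet> (x - a) + s / 2 * (norm (x - a))\<^sup>2) S"
  shows "b \<in> S" and "\<And>w. w \<in> S \<Longrightarrow> (a - (1 / s) *\<^sub>R g - b) \<bullet> (w - b) \<le> 0"
proof -
  let ?q = "\<lambda>x. g \<bullet> (x - a) + s / 2 * (norm (x - a))\<^sup>2"
  have "continuous_on S ?q" by (intro continuous_intros)
  then obtain m where "m \<in> S" "\<And>w. w \<in> S \<Longrightarrow> ?q m \<le> ?q w"
    using continuous_attains_inf[OF S(1,3)] by blast
  then have "is_arg_min ?q (\<lambda>x. x \<in> S) m" by (auto simp: is_arg_min_linorder)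
  then have min: "is_arg_min ?q (\<lambda>x. x \<in> S) b"
    unfolding b arg_min_on_def arg_min_def by (rule someI)
  then show bS: "b \<in> S" by (simp add: is_arg_min_linorder)
  let ?c = "a - (1 / s) *\<^sub>R g"
  have sq: "s / 2 * (dist ?c x)\<^sup>2 = ?q x + (norm g)\<^sup>2 / (2 * s)" for x
  proof -
    have "(dist ?c x)\<^sup>2 = (norm ((x - a) + (1 / s) *\<^sub>R g))\<^sup>2"
      by (simp add: dist_norm norm_minus_commute algebra_simps)
    also have "\<dots> = (norm (x - a))\<^sup>2 + 2 / s * (g \<bullet> (x - a)) + (norm g)\<^sup>2 / s\<^sup>2"
      unfolding power2_norm_eq_inner
      by (simp add: inner_add_left inner_add_right inner_commute[of "x - a" g] power2_eq_square add_divide_distrib)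
    finally show ?thesis using s by (simp add: field_simps power2_eq_square)
  qed
  have "dist ?c b \<le> dist ?c w" if "w \<in> S" for w
  proof -
    have "?q b \<le> ?q w" using min that by (simp add: is_arg_min_linorder)
    then have "s / 2 * (dist ?c b)\<^sup>2 \<le> s / 2 * (dist ?c w)\<^sup>2" unfolding sq by simp
    then have "(dist ?c b)\<^sup>2 \<le> (dist ?c w)\<^sup>2" using s by simp
    then show ?thesis by (rule power2_le_imp_le) simp
  qed
  then show "(?c - b) \<bullet> (w - b) \<le> 0" if "w \<in> S" for w
    using any_closest_point_dot[OF S(2) compact_imp_closed[OF S(1)] bS that] by blast
qed

text \<open>
  The Lipschitz condition is directional and confined to the segment because it is applied where the
  gradient is controlled in a single block and on a bounded set.
\<close>

lemma descent_lemma_along: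
  fixes f :: "'a::real_inner \<Rightarrow> real"
  assumes der: "\<And>t. 0 \<le> t \<Longrightarrow> t \<le> 1 \<Longrightarrow> (f has_derivative (\<lambda>d. G (x + t *\<^sub>R v) \<bullet> d)) (at (x + t *\<^sub>R v))"
    and lip: "\<And>t. 0 \<le> t \<Longrightarrow> t \<le> 1 \<Longrightarrow> (G (x + t *\<^sub>R v) - G x) \<bullet> v \<le> L * t * (norm v)\<^sup>2"
  shows "f (x + v) \<le> f x + G x \<bullet> v + L / 2 * (norm v)\<^sup>2"
proof -
  define c where "c t = f (x + t *\<^sub>R v) - t * (G x \<bullet> v) - L / 2 * t\<^sup>2 * (norm v)\<^sup>2" for t
  have "c 1 \<le> c 0"
  proof (rule DERIV_nonpos_imp_nonincreasing[of 0 1 c])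
    fix t :: real assume t: "0 \<le> t" "t \<le> 1"
    have "((\<lambda>t. x + t *\<^sub>R v) has_derivative (\<lambda>t. t *\<^sub>R v)) (at t)"
      by (auto intro!: derivative_eq_intros)
    from has_derivative_compose[OF this der[OF t]]
    have "((\<lambda>t. f (x + t *\<^sub>R v)) has_real_derivative G (x + t *\<^sub>R v) \<bullet> v) (at t)"
      by (simp add: has_field_derivative_def mult.commute[of _ "G (x + t *\<^sub>R v) \<bullet> v"])
    then have "(c has_real_derivative (G (x + t *\<^sub>R v) \<bullet> v - G x \<bullet> v - L * t * (norm v)\<^sup>2)) (at t)"
      unfolding c_def by (auto intro!: derivative_eq_intros)
    moreover have "G (x + t *\<^sub>R v) \<bullet> v - G x \<bullet> v - L * t * (norm v)\<^sup>2 \<le> 0"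
      using lip[OF t] by (simp add: inner_diff_left)
    ultimately show "\<exists>y. (c has_real_derivative y) (at t) \<and> y \<le> 0" by blast
  qed simp
  then show ?thesis by (simp add: c_def)
qed

section \<open>Block structure\<close>

lemma block_of_nth [simp]: "block_of blk i z $ j = (if blk j = i then z $ j else 0)"
  by (simp add: block_of_def)

lemma linear_block_of: "linear (block_of blk i)"
  by (rule linearI) (auto simp: vec_eq_iff)

lemmas block_of_add = linear_add[OF linear_block_of]
  and block_of_diff = linear_diff[OF linear_block_of]
  and block_of_scaleR = linear_cmul[OF linear_block_of]

lemma subspace_block_space: "subspace (block_space blk i)"
  by (auto simp: subspace_def block_space_def)

lemma block_of_mem [simp]: "block_of blk i z \<in> block_space blk i"
  by (simp add: block_space_def)

lemma block_of_id: "w \<in> block_space blk i \<Longrightarrow> block_of blk i w = w"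
  by (auto simp: block_space_def vec_eq_iff)

lemma block_of_idem [simp]: "block_of blk i (block_of blk i z) = block_of blk i z"
  by (simp add: block_of_id)

lemma inner_block_of_swap: "block_of blk i x \<bullet> y = x \<bullet> block_of blk i y"
  unfolding inner_vec_def by (rule sum.cong) auto

lemma inner_block_of_block_of: "block_of blk i x \<bullet> block_of blk i y = x \<bullet> block_of blk i y"
  by (simp add: inner_block_of_swap)

lemma norm_block_of_le: "norm (block_of blk i z) \<le> norm z"
  by (rule norm_le_componentwise_cart) auto

lemma sum_block_of:
  assumes "range blk = {1..n}"
  shows "(\<Sum>i\<in>{1..n}. block_of blk i z) = z"
proof -
  have "blk j \<in> {1..n}" for j using assms by auto
  then show ?thesis by (simp add: vec_eq_iff)
qed

lemma inner_eq_sum_blocks: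
  assumes "range blk = {1..n}"
  shows "x \<bullet> y = (\<Sum>i\<in>{1..n}. x \<bullet> block_of blk i y)"
  unfolding inner_sum_right[symmetric] sum_block_of[OF assms] ..

lemma norm_power2_eq_sum_blocks:
  assumes "range blk = {1..n}"
  shows "(norm x)\<^sup>2 = (\<Sum>i\<in>{1..n}. (norm (block_of blk i x))\<^sup>2)"
  unfolding power2_norm_eq_inner inner_block_of_block_of inner_eq_sum_blocks[OF assms, symmetric] ..

lemma norm_le_sum_blocks:
  assumes "range blk = {1..n}"
  shows "norm x \<le> (\<Sum>i\<in>{1..n}. norm (block_of blk i x))"
  using norm_sum[of "\<lambda>i. block_of blk i x" "{1..n}"] unfolding sum_block_of[OF assms] .

text \<open>
  Replacing a block is affine in the new block, with the projection \<open>block_of blk i\<close> as its linear part.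
\<close>

lemma block_grad_eq:
  assumes "(f has_derivative (\<lambda>d. g \<bullet> d)) (at z)"
  shows "block_grad blk f i z = block_of blk i g"
  unfolding block_grad_def
proof (rule grad_on_eqI[OF subspace_block_space block_of_mem block_of_mem])
  let ?r = "\<lambda>w. replace_block blk i w z"
  have r: "?r = (\<lambda>w. (z - block_of blk i z) + block_of blk i w)"
    by (auto simp: replace_block_def vec_eq_iff fun_eq_iff)
  have "(block_of blk i has_derivative block_of blk i) (at (block_of blk i z))"
    by (rule linear_imp_has_derivative[OF linear_block_of])
  then have "(?r has_derivative block_of blk i) (at (block_of blk i z))"
    unfolding r by (auto intro!: derivative_eq_intros)
  moreover have "(f has_derivative (\<lambda>d. g \<bullet> d)) (at (?r (block_of blk i z)))"
  proof -
    have "?r (block_of blk i z) = z" by (simp add: replace_block_def vec_eq_iff)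
    then show ?thesis using assms by simp
  qed
  ultimately have der: "((\<lambda>w. f (?r w)) has_derivative (\<lambda>d. g \<bullet> block_of blk i d)) (at (block_of blk i z))"
    by (rule has_derivative_compose)
  have eq: "(\<lambda>d. block_of blk i g \<bullet> d) = (\<lambda>d. g \<bullet> block_of blk i d)"
    by (intro ext) (rule inner_block_of_swap)
  show "((\<lambda>w. f (?r w)) has_derivative (\<lambda>d. block_of blk i g \<bullet> d))
      (at (block_of blk i z) within block_space blk i)"
    unfolding eq using der by (rule has_derivative_at_withinI)
qed

lemma mixed_1: "range blk = {1..n} \<Longrightarrow> mixed blk z k 1 = z k"
proof -
  assume blk: "range blk = {1..n}"
  have "\<forall>j. blk j \<noteq> 0" using rangeI[of blk] unfolding blk by (metis atLeastAtMost_iff not_one_le_zero)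
  then show ?thesis by (simp add: mixed_def vec_eq_iff) (metis less_irrefl)
qed

lemma mixed_last: "range blk = {1..n} \<Longrightarrow> mixed blk z k (Suc n) = z (Suc k)"
proof -
  assume blk: "range blk = {1..n}"
  have "blk j < Suc n" for j using rangeI[of blk j] unfolding blk by simp
  then show ?thesis by (simp add: mixed_def vec_eq_iff)
qed

text \<open>
  The points \<open>mixed blk z k 1\<close>, ..., \<open>mixed blk z k (Suc n)\<close> lead from \<open>z k\<close> to \<open>z (Suc k)\<close> by changing
  one block at a time, which makes the descent in the blocks telescope.
\<close>

lemma mixed_Suc: "mixed blk z k (Suc i) = mixed blk z k i + block_of blk i (z (Suc k) - z k)"
  by (auto simp: mixed_def vec_eq_iff)

lemma block_of_mixed:
  "block_of blk i (mixed blk z k j) = block_of blk i (if i < j then z (Suc k) else z k)"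
  by (auto simp: mixed_def vec_eq_iff)

lemma norm_mixed_diff_le:
  "norm (mixed blk a k i - mixed blk b k i) \<le> norm (a k - b k) + norm (a (Suc k) - b (Suc k))"
proof -
  let ?A = "\<chi> j. if blk j < i then 0 else (a k - b k) $ j"
  let ?B = "\<chi> j. if blk j < i then (a (Suc k) - b (Suc k)) $ j else 0"
  have "mixed blk a k i - mixed blk b k i = ?A + ?B"
    by (auto simp: mixed_def vec_eq_iff)
  also have "norm \<dots> \<le> norm ?A + norm ?B" by (rule norm_triangle_ineq)
  also have "\<dots> \<le> norm (a k - b k) + norm (a (Suc k) - b (Suc k))"
    by (intro add_mono norm_le_componentwise_cart) auto
  finally show ?thesis .
qed

section \<open>Subgradients of a constrained objective\<close>

lemma objective_eq:
  "objective blk n p f h w = (if w \<in> block_prod blk n (feas blk p h) then ereal (f w) else \<infinity>)"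
proof (cases "w \<in> block_prod blk n (feas blk p h)")
  case True
  then show ?thesis by (simp add: objective_def block_prod_def indicator_fun_def)
next
  case False
  then obtain i where i: "i \<in> {1..n}" "block_of blk i w \<notin> feas blk p h i"
    by (auto simp: block_prod_def)
  have "(\<Sum>i\<in>{1..n}. indicator_fun (feas blk p h i) (block_of blk i w)) = \<infinity>"
    using i by (subst sum_Pinfty) (auto simp: indicator_fun_def)
  then show ?thesis using False by (simp add: objective_def)
qed

text \<open>
  The last premise says that \<open>u - g\<close> lies in the normal cone of \<open>P\<close> at \<open>x\<close>.  At points of \<open>P\<close>
  the difference quotient is therefore at least that of \<open>f\<close> with its derivative, which tends to 0;
  at the other points it is infinite.
\<close>

lemma frechet_subdiff_constrained:
  fixes f :: "'a::euclidean_space \<Rightarrow> real"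
  assumes F: "\<And>w. F w = (if w \<in> P then ereal (f w) else \<infinity>)" and x: "x \<in> P"
    and der: "(f has_derivative (\<lambda>d. g \<bullet> d)) (at x)"
    and normal: "\<And>w. w \<in> P \<Longrightarrow> 0 \<le> (g - u) \<bullet> (w - x)"
  shows "u \<in> frechet_subdiff F x"
  unfolding frechet_subdiff_def
proof (intro CollectI conjI)
  show "F x < \<infinity>" using F x by simp
  let ?Q = "\<lambda>w. (F w - F x - ereal (u \<bullet> (w - x))) / ereal (norm (w - x))"
  show "0 \<le> Liminf (at x) ?Q"
    unfolding le_Liminf_iff
  proof (intro allI impI)
    fix c :: ereal assume "c < 0"
    then obtain e where e: "c < ereal e" "e < 0" using ereal_dense2[of c 0] by auto
    have "((\<lambda>w. (1 / norm (w - x)) *\<^sub>R (f w - (f x + g \<bullet> (w - x)))) \<longlongrightarrow> 0) (at x)"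
      using der unfolding has_derivative_within by blast
    then have "\<forall>\<^sub>F w in at x. e < (1 / norm (w - x)) *\<^sub>R (f w - (f x + g \<bullet> (w - x)))"
      using e(2) by (rule order_tendstoD)
    moreover have "\<forall>\<^sub>F w in at x. w \<noteq> x" by (simp add: eventually_at_filter)
    ultimately show "\<forall>\<^sub>F w in at x. c < ?Q w"
    proof eventually_elim
      case (elim w)
      have nz: "0 < norm (w - x)" using elim by simp
      show ?case
      proof (cases "w \<in> P")
        case True
        have "(1 / norm (w - x)) *\<^sub>R (f w - (f x + g \<bullet> (w - x))) \<le> (f w - f x - u \<bullet> (w - x)) / norm (w - x)"
          using normal[OF True] nz by (simp add: divide_right_mono inner_diff_left)
        then have "e < (f w - f x - u \<bullet> (w - x)) / norm (w - x)" using elim by linarith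
        then have "ereal e < ?Q w" using True x F nz by simp
        with e(1) show ?thesis by (rule less_trans)
      next
        case False
        then have "?Q w = \<infinity>" using F x nz by simp
        then show ?thesis using less_trans[OF e(1), of \<infinity>] by simp
      qed
    qed
  qed
qed

lemma lojasiewicz_exponent_constrained:
  fixes f :: "'a::euclidean_space \<Rightarrow> real"
  assumes F: "\<And>w. F w = (if w \<in> P then ereal (f w) else \<infinity>)" and x: "x \<in> P"
    and loj: "lojasiewicz_exponent F x \<theta>"
  obtains c \<eta> where "0 < c" "0 < \<eta>"
    "\<And>w u. w \<in> P \<Longrightarrow> w \<in> cball x \<eta> \<Longrightarrow> u \<in> frechet_subdiff F w \<Longrightarrow> \<bar>f w - f x\<bar> powr \<theta> \<le> c * norm u"
proof -
  obtain c \<eta> where c: "0 < c" "0 < \<eta>" and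
    b: "\<And>w. w \<in> cball x \<eta> \<Longrightarrow> epowr \<bar>F w - F x\<bar> \<theta> \<le> ereal c * (INF u\<in>frechet_subdiff F w. ereal (dist 0 u))"
    using loj unfolding lojasiewicz_exponent_def by blast
  have "\<bar>f w - f x\<bar> powr \<theta> \<le> c * norm u"
    if w: "w \<in> P" "w \<in> cball x \<eta>" and u: "u \<in> frechet_subdiff F w" for w u
  proof -
    have "ereal (\<bar>f w - f x\<bar> powr \<theta>) = epowr \<bar>F w - F x\<bar> \<theta>"
      using w x F by (simp add: epowr_def)
    also have "epowr \<bar>F w - F x\<bar> \<theta> \<le> ereal c * (INF u\<in>frechet_subdiff F w. ereal (dist 0 u))"
      using b w by blast
    also have "\<dots> \<le> ereal c * ereal (dist 0 u)"
      using c u by (intro ereal_mult_left_mono INF_lower) auto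
    finally show ?thesis by simp
  qed
  then show thesis using that c by blast
qed

section \<open>From the residual to the distance from the exact solution\<close>

text \<open>
  Convexity gives \<open>lam l * (grad h_l x \<bullet> (w - x)) \<le> - lam l * h_l x\<close> for feasible \<open>w\<close>, so the multipliers
  enter only through the complementarity term, which is part of the residual and
  therefore small no matter how large the multipliers are.
\<close>

lemma residual_variational:
  fixes x xt w :: "real ^ 'N::finite"
  assumes p: "1 \<le> p i" and x: "x \<in> block_space blk i" and w: "w \<in> feas blk p h i"
    and cvx: "\<And>l. l \<in> {1..p i} \<Longrightarrow> convex_on (block_space blk i) (h i l) \<and> h i l differentiable_on block_space blk i"
    and lam: "\<And>l. l \<in> {1..p i} \<Longrightarrow> 0 \<le> lam l"
    and res: "residual blk p h i x lam xt \<le> e"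
  shows "(xt - x) \<bullet> (w - x) \<le> e * (sqrt (real DIM(real ^ 'N)) * norm w + 2)"
    and "L2_set (\<lambda>l. max (h i l x) 0) {1..p i} \<le> real (p i) * e"
proof -
  let ?I = "{1..p i}"
  let ?dh = "\<lambda>l. grad_on (block_space blk i) (h i l) x"
  define g where "g = x - xt + (\<Sum>l\<in>?I. lam l *\<^sub>R ?dh l)"
  define m where "m = (MAX l\<in>?I. \<bar>max (h i l x) 0\<bar>)"
  have mge: "\<bar>max (h i l x) 0\<bar> \<le> m" if "l \<in> ?I" for l
    unfolding m_def using that by (intro Max_ge) auto
  have "0 \<le> m" using mge[of 1] p by (simp add: order_trans[OF abs_ge_zero])
  moreover have "0 \<le> infnorm g" by (rule infnorm_pos_le)
  moreover have "max (x \<bullet> g) 0 + infnorm g + m + max (- (\<Sum>l\<in>?I. lam l * h i l x)) 0 \<le> e"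
    using res by (simp add: residual_def Let_def g_def m_def)
  ultimately have parts: "x \<bullet> g \<le> e" "infnorm g \<le> e" "m \<le> e" "- (\<Sum>l\<in>?I. lam l * h i l x) \<le> e"
    by linarith+
  have e: "0 \<le> e" using parts(2) infnorm_pos_le[of g] by linarith
  have wV: "w \<in> block_space blk i" using w by (simp add: feas_def)
  have tangent: "lam l * (?dh l \<bullet> (w - x)) \<le> - (lam l * h i l x)" if l: "l \<in> ?I" for l
  proof -
    have "h i l x + ?dh l \<bullet> (w - x) \<le> h i l w"
      using convex_on_above_gradient[OF subspace_block_space x wV] cvx[OF l] x
      by (auto simp: differentiable_on_def)
    moreover have "h i l w \<le> 0" using w l by (simp add: feas_def)
    ultimately have "?dh l \<bullet> (w - x) \<le> - h i l x" by linarith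
    then show ?thesis using mult_left_mono[OF _ lam[OF l]] by fastforce
  qed
  have "(xt - x) \<bullet> (w - x) = (\<Sum>l\<in>?I. lam l * (?dh l \<bullet> (w - x))) - g \<bullet> (w - x)"
    by (simp add: g_def inner_add_left inner_diff_left inner_sum_left)
  also have "\<dots> \<le> (\<Sum>l\<in>?I. - (lam l * h i l x)) - g \<bullet> (w - x)"
    by (intro diff_right_mono sum_mono tangent)
  also have "\<dots> = - (\<Sum>l\<in>?I. lam l * h i l x) + x \<bullet> g - g \<bullet> w"
    by (simp add: sum_negf inner_diff_right inner_commute)
  also have "\<dots> \<le> - (\<Sum>l\<in>?I. lam l * h i l x) + x \<bullet> g + norm g * norm w"
    using Cauchy_Schwarz_ineq2[of g w] by linarith
  also have "norm g * norm w \<le> (sqrt (real DIM(real ^ 'N)) * e) * norm w"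
    using norm_le_infnorm[of g] parts(2)
    by (intro mult_right_mono) (auto intro: order_trans mult_left_mono)
  finally show "(xt - x) \<bullet> (w - x) \<le> e * (sqrt (real DIM(real ^ 'N)) * norm w + 2)"
    using parts by (simp add: algebra_simps)
  have "L2_set (\<lambda>l. max (h i l x) 0) ?I \<le> (\<Sum>l\<in>?I. max (h i l x) 0)"
    by (rule L2_set_le_sum) simp
  also have "\<dots> \<le> (\<Sum>l\<in>?I. e)"
    using mge parts(3) by (intro sum_mono) (meson abs_ge_self order_trans)
  finally show "L2_set (\<lambda>l. max (h i l x) 0) ?I \<le> real (p i) * e" by simp
qed

text \<open>
  The two variational inequalities of \<open>x\<close> and of the projection \<open>b\<close> are added.  As \<open>x\<close> may be
  infeasible, the second one is tested with the projection of \<open>x\<close> onto \<open>S\<close>, at the cost of the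
  last term.
\<close>

lemma inexact_projection_distance:
  fixes S :: "'a::euclidean_space set"
  assumes S: "closed S" "S \<noteq> {}" and b: "b \<in> S" "\<And>w. w \<in> S \<Longrightarrow> (xt - b) \<bullet> (w - b) \<le> 0"
    and x: "(xt - x) \<bullet> (b - x) \<le> e"
  shows "(norm (x - b))\<^sup>2 \<le> e + norm (xt - b) * infdist x S"
proof -
  obtain q where q: "q \<in> S" "infdist x S = dist x q"
    using infdist_attains_inf[OF S] by blast
  have "(norm (x - b))\<^sup>2 = (xt - x) \<bullet> (b - x) + (xt - b) \<bullet> (q - b) + (xt - b) \<bullet> (x - q)"
    by (simp add: power2_norm_eq_inner inner_diff_left inner_diff_right)
  also have "\<dots> \<le> e + 0 + norm (xt - b) * norm (x - q)"
    by (intro add_mono x b(2) q(1) norm_cauchy_schwarz)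
  finally show ?thesis using q(2) by (simp add: dist_norm)
qed

section \<open>A run of the algorithm\<close>

locale palm_run =
  fixes blk :: "'N::finite \<Rightarrow> nat" and n :: nat and p :: "nat \<Rightarrow> nat"
    and f :: "real ^ 'N \<Rightarrow> real" and h :: "nat \<Rightarrow> nat \<Rightarrow> real ^ 'N \<Rightarrow> real"
    and \<epsilon>bar \<rho> \<gamma> L Ml M :: real and \<epsilon> Ls :: "nat \<Rightarrow> real" and \<sigma> :: "nat \<Rightarrow> nat \<Rightarrow> real"
    and z :: "nat \<Rightarrow> real ^ 'N" and zb0 :: "real ^ 'N"
  assumes blocks: "range blk = {1..n}"
    and p_pos: "\<forall>i\<in>{1..n}. 1 \<le> p i"
    and f_diff: "f differentiable_on UNIV"
    and h_convex_diff: "\<forall>i\<in>{1..n}. \<forall>l\<in>{1..p i}.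
          convex_on (block_space blk i) (h i l) \<and> h i l differentiable_on block_space blk i"
    and L_def: "L = (MAX i\<in>{1..n}. Ls i)"
    and gamma: "1 < \<gamma>" and Ml_def: "Ml = \<gamma> * L"
    and rho: "0 < \<rho>" "\<rho> < 1" and eps: "\<forall>k. \<epsilon> k = \<epsilon>bar * \<rho> ^ k"
    and palm: "palm_I blk n p f h \<epsilon>bar \<epsilon> Ml M \<sigma> z"
    and zb0: "zb0 \<in> block_prod blk n (feas blk p h)"
    and hyp1: "\<forall>i\<in>{1..n}. 0 < Ls i \<and>
          (\<forall>z1\<in>block_prod blk n (feas_bar blk p h \<epsilon>bar).
           \<forall>z2\<in>block_prod blk n (feas_bar blk p h \<epsilon>bar).
             norm (block_grad blk f i z1 - block_grad blk f i z2) \<le> Ls i * norm (z1 - z2))"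
    and hyp2: "\<forall>i\<in>{1..n}. convex (feas blk p h i) \<and> compact (feas blk p h i) \<and>
          (\<exists>c\<ge>0. \<forall>x\<in>feas_tilde blk n p f h \<epsilon>bar Ml i.
             infdist x (feas blk p h i) \<le> c * L2_set (\<lambda>l. max (h i l x) 0) {1..p i})"
begin

text \<open>
  The sets \<open>P\<close> and \<open>Pbar\<close> are the feasible set and its enlargement on which the block gradients are
  Lipschitz; \<open>y\<close> is the sequence of exact subproblem solutions.
\<close>

definition G :: "real ^ 'N \<Rightarrow> real ^ 'N" where "G w = grad_on UNIV f w"

abbreviation S :: "nat \<Rightarrow> (real ^ 'N) set" where "S \<equiv> feas blk p h"
definition P :: "(real ^ 'N) set" where "P = block_prod blk n S"
definition Pbar :: "(real ^ 'N) set" where "Pbar = block_prod blk n (feas_bar blk p h \<epsilon>bar)"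
definition y :: "nat \<Rightarrow> real ^ 'N" where "y = z_bar blk p f h \<sigma> z zb0"

lemma G_derivative: "(f has_derivative (\<lambda>d. G w \<bullet> d)) (at w)"
  unfolding G_def
  using grad_on_derivative(2)[OF subspace_UNIV UNIV_I, of f w] f_diff by (simp add: differentiable_on_def)

lemma block_grad_G: "block_grad blk f i w = block_of blk i (G w)"
  by (rule block_grad_eq[OF G_derivative])

lemma n_pos: "1 \<le> n"
  using blocks by (cases n) auto

lemma Ls_le: "i \<in> {1..n} \<Longrightarrow> Ls i \<le> L"
  unfolding L_def by (intro Max_ge) auto

lemma L_pos: "0 < L"
proof -
  have "1 \<in> {1..n}" using n_pos by simp
  then show ?thesis using hyp1 Ls_le[of 1] by (meson less_le_trans)
qed

lemma eps_bar_pos: "0 < \<epsilon>bar"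
  using palm by (simp add: palm_I_def)

lemma sigma_bounds: "i \<in> {1..n} \<Longrightarrow> Ml \<le> \<sigma> k i" "i \<in> {1..n} \<Longrightarrow> \<sigma> k i \<le> M"
  using palm by (auto simp: palm_I_def)

lemma L_le_Ml: "L \<le> Ml"
  unfolding Ml_def using gamma L_pos by simp

lemma sigma_pos: "i \<in> {1..n} \<Longrightarrow> 0 < \<sigma> k i"
  using sigma_bounds(1)[of i k] L_pos L_le_Ml by linarith

lemma M_pos: "0 < M"
  using sigma_bounds[of 1 0] n_pos L_pos L_le_Ml by simp

lemma S_compact: "i \<in> {1..n} \<Longrightarrow> compact (S i)"
  and S_convex: "i \<in> {1..n} \<Longrightarrow> convex (S i)"
  using hyp2 by auto

lemma S_closed: "i \<in> {1..n} \<Longrightarrow> closed (S i)"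
  by (simp add: S_compact compact_imp_closed)

lemma S_nonempty: "i \<in> {1..n} \<Longrightarrow> S i \<noteq> {}"
  using zb0 by (auto simp: block_prod_def)

lemma S_block: "w \<in> S i \<Longrightarrow> w \<in> block_space blk i"
  by (simp add: feas_def)

lemma S_subset_feas_bar: "S i \<subseteq> feas_bar blk p h \<epsilon>bar i"
  using eps_bar_pos by (auto simp: feas_bar_def feas_def)

lemma P_subset_Pbar: "P \<subseteq> Pbar"
  using S_subset_feas_bar by (auto simp: P_def Pbar_def block_prod_def)

lemma P_block: "w \<in> P \<Longrightarrow> i \<in> {1..n} \<Longrightarrow> block_of blk i w \<in> S i"
  by (simp add: P_def block_prod_def)

lemma P_convex: "convex P"
  unfolding convex_def
proof (intro ballI allI impI)
  fix a b :: "real ^ 'N" and u v :: real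
  assume a: "a \<in> P" "b \<in> P" and uv: "0 \<le> u" "0 \<le> v" "u + v = 1"
  have "u *\<^sub>R block_of blk i a + v *\<^sub>R block_of blk i b \<in> S i" if "i \<in> {1..n}" for i
    using S_convex[OF that] P_block[OF _ that] a uv by (auto simp: convex_def)
  then show "u *\<^sub>R a + v *\<^sub>R b \<in> P"
    by (simp add: P_def block_prod_def block_of_add block_of_scaleR)
qed

lemma bounded_of_bounded_blocks:
  assumes "\<And>i. i \<in> {1..n} \<Longrightarrow> bounded (A i)"
  shows "bounded (block_prod blk n A)"
proof -
  have "\<exists>R. \<forall>w\<in>A i. norm w \<le> R" if "i \<in> {1..n}" for i
    using assms[OF that] by (simp add: bounded_iff)
  then obtain R where R: "\<And>i w. i \<in> {1..n} \<Longrightarrow> w \<in> A i \<Longrightarrow> norm w \<le> R i" by metis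
  have "norm w \<le> (\<Sum>i\<in>{1..n}. R i)" if "w \<in> block_prod blk n A" for w
    using norm_le_sum_blocks[OF blocks, of w] sum_mono[of "{1..n}" "\<lambda>i. norm (block_of blk i w)" R] R that
    by (force simp: block_prod_def)
  then show ?thesis by (auto simp: bounded_iff)
qed

lemma feas_bar_bounded:
  assumes i: "i \<in> {1..n}"
  shows "bounded (feas_bar blk p h \<epsilon>bar i)"
proof -
  obtain R where R: "\<And>w. w \<in> S i \<Longrightarrow> norm w \<le> R"
    using compact_imp_bounded[OF S_compact[OF i]] by (auto simp: bounded_iff)
  have "norm w \<le> R + \<epsilon>bar" if w: "w \<in> feas_bar blk p h \<epsilon>bar i" for w
  proof -
    obtain q where "q \<in> S i" "infdist w (S i) = dist w q"
      using infdist_attains_inf[OF S_closed[OF i] S_nonempty[OF i]] by blast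
    then show ?thesis
      using w R[of q] norm_triangle_ineq2[of w q] by (simp add: feas_bar_def dist_norm)
  qed
  then show ?thesis by (auto simp: bounded_iff)
qed

lemma Pbar_bounded: "bounded Pbar"
  unfolding Pbar_def by (rule bounded_of_bounded_blocks) (rule feas_bar_bounded)

lemma P_closed: "closed P"
proof -
  have "P = (\<Inter>i\<in>{1..n}. block_of blk i -` S i)" by (auto simp: P_def block_prod_def)
  moreover have "closed (block_of blk i -` S i)" if "i \<in> {1..n}" for i
    using S_closed[OF that] linear_continuous_at[of "block_of blk i"] linear_block_of[of blk i]
    by (intro continuous_closed_vimage) (auto simp: linear_conv_bounded_linear)
  ultimately show ?thesis by auto
qed

lemma P_compact: "compact P"
  using P_closed bounded_subset[OF Pbar_bounded P_subset_Pbar] by (simp add: compact_eq_bounded_closed)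

lemma G_lipschitz:
  assumes "i \<in> {1..n}" "v \<in> Pbar" "w \<in> Pbar"
  shows "norm (block_of blk i (G v - G w)) \<le> L * norm (v - w)"
proof -
  have "norm (block_of blk i (G v - G w)) \<le> Ls i * norm (v - w)"
    using hyp1 assms unfolding Pbar_def block_grad_G by (simp add: block_of_diff)
  also have "\<dots> \<le> L * norm (v - w)" using Ls_le assms by (intro mult_right_mono) auto
  finally show ?thesis .
qed

lemma G_bounded:
  obtains D where "0 \<le> D" "\<And>w i. w \<in> Pbar \<Longrightarrow> i \<in> {1..n} \<Longrightarrow> norm (block_of blk i (G w)) \<le> D"
proof -
  obtain R where R: "\<And>w. w \<in> Pbar \<Longrightarrow> norm w \<le> R"
    using Pbar_bounded by (auto simp: bounded_iff)
  have z0: "zb0 \<in> Pbar" using zb0 P_subset_Pbar by (auto simp: P_def)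
  show thesis
  proof
    have "0 \<le> R" using R[OF z0] norm_ge_zero order_trans by blast
    then show "0 \<le> norm (G zb0) + L * (R + R)" using L_pos by simp
    fix w i assume w: "w \<in> Pbar" and i: "i \<in> {1..n}"
    have "norm (block_of blk i (G w)) \<le> norm (block_of blk i (G zb0)) + norm (block_of blk i (G w - G zb0))"
      using norm_triangle_ineq[of "block_of blk i (G zb0)" "block_of blk i (G w - G zb0)"]
      by (simp add: block_of_diff)
    also have "\<dots> \<le> norm (G zb0) + L * norm (w - zb0)"
      by (intro add_mono norm_block_of_le G_lipschitz[OF i w z0])
    also have "L * norm (w - zb0) \<le> L * (R + R)"
      using R[OF w] R[OF z0] norm_triangle_ineq4[of w zb0] L_pos by (intro mult_left_mono) linarith+
    finally show "norm (block_of blk i (G w)) \<le> norm (G zb0) + L * (R + R)" by simp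
  qed
qed

text \<open>
  The supremum of the gradient norms is taken over a bounded set on which the gradient is Lipschitz,
  so it is a genuine supremum and nonnegative.
\<close>

lemma feas_bar_subset_feas_tilde:
  assumes i: "i \<in> {1..n}"
  shows "feas_bar blk p h \<epsilon>bar i \<subseteq> feas_tilde blk n p f h \<epsilon>bar Ml i"
proof -
  obtain D where D: "\<And>w. w \<in> Pbar \<Longrightarrow> norm (block_grad blk f i w) \<le> D"
    using G_bounded i unfolding block_grad_G by metis
  have z0: "zb0 \<in> Pbar" using zb0 P_subset_Pbar by (auto simp: P_def)
  have "norm (block_grad blk f i zb0) \<le> (SUP w\<in>Pbar. norm (block_grad blk f i w))"
    by (rule cSUP_upper[OF z0]) (use D in \<open>auto simp: bdd_above_def\<close>)
  then have "0 \<le> grad_sup blk n p f h \<epsilon>bar i"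
    unfolding grad_sup_def Pbar_def[symmetric] using norm_ge_zero order_trans by blast
  then have "0 \<le> grad_sup blk n p f h \<epsilon>bar i / Ml" using L_pos L_le_Ml by simp
  then show ?thesis by (auto simp: feas_tilde_def feas_bar_def)
qed

lemma global_error_bound:
  assumes i: "i \<in> {1..n}"
  obtains c where "0 \<le> c" "\<And>x. x \<in> block_space blk i \<Longrightarrow>
    infdist x (S i) \<le> c * L2_set (\<lambda>l. max (h i l x) 0) {1..p i}"
proof -
  obtain c where c: "0 \<le> c" "\<And>x. x \<in> feas_tilde blk n p f h \<epsilon>bar Ml i \<Longrightarrow>
      infdist x (S i) \<le> c * L2_set (\<lambda>l. max (h i l x) 0) {1..p i}"
    using hyp2 i by blast
  have "infdist x (S i) \<le> c * L2_set (\<lambda>l. max (h i l x) 0) {1..p i}" if x: "x \<in> block_space blk i" for x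
  proof (rule error_bound_extends[OF subspace_block_space finite_atLeastAtMost _ _ _ _ _ eps_bar_pos c(1) _ x])
    show "S i = {w \<in> block_space blk i. \<forall>l\<in>{1..p i}. h i l w \<le> 0}" by (simp add: feas_def)
    show "convex_on (block_space blk i) (h i l)" if "l \<in> {1..p i}" for l
      using h_convex_diff i that by blast
    show "infdist w (S i) \<le> c * L2_set (\<lambda>l. max (h i l w) 0) {1..p i}"
      if "w \<in> block_space blk i" "infdist w (S i) \<le> \<epsilon>bar" for w
      using c(2)[of w] feas_bar_subset_feas_tilde[OF i] that by (auto simp: feas_bar_def)
  qed (use i S_closed S_convex S_nonempty in auto)
  then show thesis using that c(1) by blast
qed

lemma run_certificate:
  assumes i: "i \<in> {1..n}"
  obtains lam where "\<And>l. l \<in> {1..p i} \<Longrightarrow> 0 \<le> lam l"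
    "residual blk p h i (block_of blk i (z (Suc k))) lam (x_tilde blk f \<sigma> z k i) \<le> (\<epsilon> k)\<^sup>2"
  using palm i sqrt_le_D unfolding palm_I_def by meson

lemma iterates_near_feasible:
  obtains c where "0 \<le> c"
    "\<And>i k. i \<in> {1..n} \<Longrightarrow> infdist (block_of blk i (z (Suc k))) (S i) \<le> c * (\<epsilon> k)\<^sup>2"
proof -
  have "\<exists>c\<ge>0. \<forall>k. infdist (block_of blk i (z (Suc k))) (S i) \<le> c * (\<epsilon> k)\<^sup>2" if i: "i \<in> {1..n}" for i
  proof -
    obtain c where c: "0 \<le> c" "\<And>x. x \<in> block_space blk i \<Longrightarrow>
        infdist x (S i) \<le> c * L2_set (\<lambda>l. max (h i l x) 0) {1..p i}"
      using global_error_bound[OF i] by blast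
    have "infdist (block_of blk i (z (Suc k))) (S i) \<le> c * real (p i) * (\<epsilon> k)\<^sup>2" for k
    proof -
      obtain lam where lam: "\<And>l. l \<in> {1..p i} \<Longrightarrow> 0 \<le> lam l"
        "residual blk p h i (block_of blk i (z (Suc k))) lam (x_tilde blk f \<sigma> z k i) \<le> (\<epsilon> k)\<^sup>2"
        using run_certificate[OF i] by blast
      obtain w where "w \<in> S i" using S_nonempty[OF i] by blast
      have "L2_set (\<lambda>l. max (h i l (block_of blk i (z (Suc k)))) 0) {1..p i} \<le> real (p i) * (\<epsilon> k)\<^sup>2"
        by (rule residual_variational(2)[OF _ block_of_mem \<open>w \<in> S i\<close> _ lam])
          (use p_pos h_convex_diff i in auto)
      then show ?thesis
        using c(2)[OF block_of_mem, of "z (Suc k)"] mult_left_mono[OF _ c(1)]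
        by (fastforce simp: mult.assoc)
    qed
    then show ?thesis using c(1) by (intro exI[of _ "c * real (p i)"]) auto
  qed
  then obtain c where c: "\<And>i. i \<in> {1..n} \<Longrightarrow> 0 \<le> c i"
    "\<And>i k. i \<in> {1..n} \<Longrightarrow> infdist (block_of blk i (z (Suc k))) (S i) \<le> c i * (\<epsilon> k)\<^sup>2" by metis
  show thesis
  proof
    show "0 \<le> (\<Sum>i\<in>{1..n}. c i)" using c(1) by (intro sum_nonneg)
    fix i k assume i: "i \<in> {1..n}"
    have "c i \<le> (\<Sum>i\<in>{1..n}. c i)" using c(1) i by (intro member_le_sum) auto
    then have "c i * (\<epsilon> k)\<^sup>2 \<le> (\<Sum>i\<in>{1..n}. c i) * (\<epsilon> k)\<^sup>2" by (intro mult_right_mono) auto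
    then show "infdist (block_of blk i (z (Suc k))) (S i) \<le> (\<Sum>i\<in>{1..n}. c i) * (\<epsilon> k)\<^sup>2"
      using c(2)[OF i, of k] by linarith
  qed
qed

lemma eps_tendsto_0: "\<epsilon> \<longlonglongrightarrow> 0"
proof -
  have "(\<lambda>k. \<epsilon>bar * \<rho> ^ k) \<longlonglongrightarrow> \<epsilon>bar * 0"
    using rho by (intro tendsto_mult_left LIMSEQ_realpow_zero) auto
  then show ?thesis using eps by (simp add: fun_eq_iff[symmetric])
qed

text \<open>
  The infeasibility is of order \<open>(\<epsilon> k)\<^sup>2\<close>, thus eventually below the threshold \<open>\<epsilon>bar\<close>.  The first
  iterates may lie outside \<open>Pbar\<close>, where the gradient is not controlled, but they do not affect the rate.
\<close>

lemma eventually_Pbar: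
  obtains K where "\<And>k. K \<le> k \<Longrightarrow> z k \<in> Pbar" "\<And>k i. K \<le> k \<Longrightarrow> mixed blk z k i \<in> Pbar"
proof -
  obtain c where c: "0 \<le> c"
    "\<And>i k. i \<in> {1..n} \<Longrightarrow> infdist (block_of blk i (z (Suc k))) (S i) \<le> c * (\<epsilon> k)\<^sup>2"
    using iterates_near_feasible by blast
  have "(\<lambda>k. c * (\<epsilon> k)\<^sup>2) \<longlonglongrightarrow> c * 0\<^sup>2"
    by (intro tendsto_mult_left tendsto_power eps_tendsto_0)
  then have "\<forall>\<^sub>F k in sequentially. c * (\<epsilon> k)\<^sup>2 < \<epsilon>bar"
    using eps_bar_pos by (intro order_tendstoD) auto
  then obtain K where K: "\<And>k. K \<le> k \<Longrightarrow> c * (\<epsilon> k)\<^sup>2 < \<epsilon>bar" by (auto simp: eventually_sequentially)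
  have z: "z k \<in> Pbar" if k: "Suc K \<le> k" for k
  proof -
    obtain j where "k = Suc j" "K \<le> j" using k by (cases k) auto
    then show ?thesis
      using c(2)[of _ j] K[of j] by (fastforce simp: Pbar_def block_prod_def feas_bar_def)
  qed
  have "mixed blk z k i \<in> Pbar" if "Suc K \<le> k" for k i
    using z[OF that] z[of "Suc k"] that by (simp add: Pbar_def block_prod_def block_of_mixed)
  with z show thesis by (rule that)
qed

lemma y_block:
  assumes i: "i \<in> {1..n}"
  shows "block_of blk i (y (Suc k)) \<in> S i"
    and "\<And>w. w \<in> S i \<Longrightarrow> (x_tilde blk f \<sigma> z k i - block_of blk i (y (Suc k))) \<bullet> (w - block_of blk i (y (Suc k))) \<le> 0"
proof -
  define b where "b = x_bar blk p f h \<sigma> z k i"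
  have b: "b \<in> S i" "\<And>w. w \<in> S i \<Longrightarrow> (x_tilde blk f \<sigma> z k i - b) \<bullet> (w - b) \<le> 0"
    using quadratic_model_minimizer[OF S_compact[OF i] S_convex[OF i] S_nonempty[OF i] sigma_pos[OF i]
        b_def[unfolded x_bar_def]]
    unfolding x_tilde_def by auto
  have "block_of blk i (y (Suc k)) = block_of blk i b"
    by (auto simp: y_def b_def vec_eq_iff)
  then have "block_of blk i (y (Suc k)) = b" using block_of_id[OF S_block[OF b(1)]] by simp
  with b show "block_of blk i (y (Suc k)) \<in> S i"
    "\<And>w. w \<in> S i \<Longrightarrow> (x_tilde blk f \<sigma> z k i - block_of blk i (y (Suc k))) \<bullet> (w - block_of blk i (y (Suc k))) \<le> 0"
    by auto
qed

lemma y_in_P: "y k \<in> P"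
proof (cases k)
  case 0
  then show ?thesis using zb0 by (simp add: y_def P_def)
next
  case (Suc j)
  then show ?thesis using y_block(1) by (simp add: P_def block_prod_def)
qed

lemma mixed_y_in_P: "mixed blk y k i \<in> P"
  using y_in_P[of k] y_in_P[of "Suc k"] by (simp add: P_def block_prod_def block_of_mixed)

text \<open>
  Both terms in the bound for the squared distance to a projection are of order \<open>(\<epsilon> k)\<^sup>2\<close>: the first by
  the residual test, the second by the error bound, since the gradient steps stay bounded.
\<close>

lemma inexactness_geometric:
  obtains C K where "0 < C" "\<And>k. K \<le> k \<Longrightarrow> norm (y k - z k) \<le> C * \<rho> ^ k"
proof -
  obtain c where c: "0 \<le> c"
    "\<And>i k. i \<in> {1..n} \<Longrightarrow> infdist (block_of blk i (z (Suc k))) (S i) \<le> c * (\<epsilon> k)\<^sup>2"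
    using iterates_near_feasible by blast
  obtain K where K: "\<And>k. K \<le> k \<Longrightarrow> z k \<in> Pbar" "\<And>k i. K \<le> k \<Longrightarrow> mixed blk z k i \<in> Pbar"
    using eventually_Pbar by blast
  obtain D where D: "0 \<le> D" "\<And>w i. w \<in> Pbar \<Longrightarrow> i \<in> {1..n} \<Longrightarrow> norm (block_of blk i (G w)) \<le> D"
    using G_bounded by blast
  obtain R where R: "\<And>w. w \<in> Pbar \<Longrightarrow> norm w \<le> R"
    using Pbar_bounded by (auto simp: bounded_iff)
  have R0: "0 \<le> R" using R[OF K(1)[OF order_refl]] norm_ge_zero order_trans by blast
  define A where "A = sqrt (real DIM(real ^ 'N)) * R + 2 + (2 * R + D / L) * c"
  have A: "0 \<le> A" using R0 D L_pos c(1) by (simp add: A_def)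
  have block: "norm (block_of blk i (y (Suc k) - z (Suc k))) \<le> sqrt A * \<epsilon> k"
    if k: "K \<le> k" and i: "i \<in> {1..n}" for k i
  proof -
    let ?x = "block_of blk i (z (Suc k))" and ?b = "block_of blk i (y (Suc k))"
    let ?t = "x_tilde blk f \<sigma> z k i"
    obtain lam where lam: "\<And>l. l \<in> {1..p i} \<Longrightarrow> 0 \<le> lam l"
      "residual blk p h i ?x lam ?t \<le> (\<epsilon> k)\<^sup>2"
      using run_certificate[OF i] by blast
    have yR: "norm ?b \<le> R"
      using norm_block_of_le[of blk i "y (Suc k)"] R[of "y (Suc k)"] y_in_P[of "Suc k"] P_subset_Pbar by force
    have "norm ?t \<le> norm (block_of blk i (z k)) + 1 / \<sigma> k i * norm (block_of blk i (G (mixed blk z k i)))"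
      unfolding x_tilde_def block_grad_G
      using norm_triangle_ineq4[of "block_of blk i (z k)" "(1 / \<sigma> k i) *\<^sub>R block_of blk i (G (mixed blk z k i))"]
        sigma_pos[OF i, of k] by simp
    also have "\<dots> \<le> R + 1 / L * D"
    proof (intro add_mono mult_mono)
      show "norm (block_of blk i (z k)) \<le> R"
        using norm_block_of_le[of blk i "z k"] R[OF K(1)[OF k]] by linarith
      show "1 / \<sigma> k i \<le> 1 / L"
        using sigma_bounds(1)[OF i, of k] L_le_Ml L_pos by (intro divide_left_mono) auto
    qed (use D K k i L_pos in auto)
    finally have tb: "norm (?t - ?b) \<le> 2 * R + D / L"
      using yR norm_triangle_ineq4[of ?t ?b] by simp
    have "(?t - ?x) \<bullet> (?b - ?x) \<le> (\<epsilon> k)\<^sup>2 * (sqrt (real DIM(real ^ 'N)) * norm ?b + 2)"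
      by (rule residual_variational(1)[OF _ block_of_mem y_block(1)[OF i] _ lam])
        (use p_pos h_convex_diff i in auto)
    then have "(norm (?x - ?b))\<^sup>2 \<le> (\<epsilon> k)\<^sup>2 * (sqrt (real DIM(real ^ 'N)) * norm ?b + 2)
        + norm (?t - ?b) * infdist ?x (S i)"
      using inexact_projection_distance[OF S_closed[OF i] S_nonempty[OF i] y_block(1)[OF i]]
        y_block(2)[OF i] by blast
    also have "\<dots> \<le> (\<epsilon> k)\<^sup>2 * (sqrt (real DIM(real ^ 'N)) * R + 2) + (2 * R + D / L) * (c * (\<epsilon> k)\<^sup>2)"
    proof (intro add_mono mult_left_mono mult_mono)
      show "infdist ?x (S i) \<le> c * (\<epsilon> k)\<^sup>2" by (rule c(2)[OF i])
    qed (use yR tb R0 D L_pos infdist_nonneg in auto)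
    also have "\<dots> = A * (\<epsilon> k)\<^sup>2" by (simp add: A_def algebra_simps)
    finally have "norm (?x - ?b) \<le> sqrt (A * (\<epsilon> k)\<^sup>2)" by (rule real_le_rsqrt)
    also have "\<dots> = sqrt A * \<epsilon> k"
      using eps eps_bar_pos rho by (simp add: real_sqrt_mult)
    finally show ?thesis by (simp add: block_of_diff norm_minus_commute)
  qed
  define B where "B = real n * (sqrt A * \<epsilon>bar) / \<rho> + 1"
  show thesis
  proof
    show "0 < B" using A eps_bar_pos rho by (simp add: B_def add_nonneg_pos)
    fix k assume "Suc K \<le> k"
    then obtain j where j: "k = Suc j" "K \<le> j" by (cases k) auto
    have "norm (y k - z k) \<le> (\<Sum>i\<in>{1..n}. norm (block_of blk i (y k - z k)))"
      by (rule norm_le_sum_blocks[OF blocks])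
    also have "\<dots> \<le> (\<Sum>i\<in>{1..n}. sqrt A * \<epsilon> j)"
      unfolding j(1) using block[OF j(2)] by (intro sum_mono) auto
    also have "\<dots> = (B - 1) * \<rho> ^ k"
      using eps rho by (simp add: B_def j)
    also have "\<dots> \<le> B * \<rho> ^ k" using rho by (intro mult_right_mono) auto
    finally show "norm (y k - z k) \<le> B * \<rho> ^ k" .
  qed
qed

section \<open>Descent and approximate stationarity\<close>

definition inexactness :: "nat \<Rightarrow> real" where
  "inexactness k = norm (y k - z k) + norm (y (Suc k) - z (Suc k))"

lemma norm_mixed_gap: "norm (mixed blk y k i - mixed blk z k i) \<le> inexactness k"
  unfolding inexactness_def by (rule norm_mixed_diff_le)

text \<open>
  The variational inequality of the new exact solution is tested with the old one.  It involves the
  gradient at the mixed iterate \<open>?m\<close> and the centre \<open>z k\<close>.  Moving the gradient to the mixed exact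
  point \<open>?a\<close> and the centre to \<open>y k\<close> costs a multiple of \<open>inexactness k * norm v\<close>, which is split by
  Young's inequality.
\<close>

lemma block_descent:
  assumes i: "i \<in> {1..n}" and m: "mixed blk z k i \<in> Pbar"
  defines "v \<equiv> block_of blk i (y (Suc k) - y k)"
  shows "f (mixed blk y k (Suc i)) \<le> f (mixed blk y k i) - L / 4 * (norm v)\<^sup>2 + (L + M)\<^sup>2 / L * (inexactness k)\<^sup>2"
proof -
  let ?a = "mixed blk y k i" and ?m = "mixed blk z k i"
  let ?b = "block_of blk i (y (Suc k))" and ?w = "block_of blk i (y k)"
  have v: "v = ?b - ?w" by (simp add: v_def block_of_diff)
  have bv: "block_of blk i v = v" by (simp add: v_def)
  have succ: "mixed blk y k (Suc i) = ?a + v" by (simp add: mixed_Suc v_def)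
  have E0: "0 \<le> inexactness k" by (simp add: inexactness_def)
  have aP: "?a \<in> P" "?a + v \<in> P" using mixed_y_in_P[of k i] mixed_y_in_P[of k "Suc i"] by (auto simp: succ)
  have segment: "?a + t *\<^sub>R v \<in> Pbar" if "0 \<le> t" "t \<le> 1" for t
  proof -
    have "(1 - t) *\<^sub>R ?a + t *\<^sub>R (?a + v) \<in> P"
      using P_convex aP that by (intro convexD) auto
    moreover have "(1 - t) *\<^sub>R ?a + t *\<^sub>R (?a + v) = ?a + t *\<^sub>R v" by (simp add: algebra_simps)
    ultimately show ?thesis using P_subset_Pbar by auto
  qed
  have "f (?a + v) \<le> f ?a + G ?a \<bullet> v + L / 2 * (norm v)\<^sup>2"
  proof (rule descent_lemma_along)
    fix t :: real assume t: "0 \<le> t" "t \<le> 1"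
    show "(f has_derivative (\<lambda>d. G (?a + t *\<^sub>R v) \<bullet> d)) (at (?a + t *\<^sub>R v))" by (rule G_derivative)
    have "(G (?a + t *\<^sub>R v) - G ?a) \<bullet> v = block_of blk i (G (?a + t *\<^sub>R v) - G ?a) \<bullet> v"
      using inner_block_of_swap[of blk i "G (?a + t *\<^sub>R v) - G ?a" v] by (simp add: bv)
    also have "\<dots> \<le> norm (block_of blk i (G (?a + t *\<^sub>R v) - G ?a)) * norm v"
      by (rule norm_cauchy_schwarz)
    also have "\<dots> \<le> L * norm (t *\<^sub>R v) * norm v"
      using G_lipschitz[OF i segment[OF t], of ?a] aP P_subset_Pbar by (intro mult_right_mono) auto
    finally show "(G (?a + t *\<^sub>R v) - G ?a) \<bullet> v \<le> L * t * (norm v)\<^sup>2"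
      using t by (simp add: power2_eq_square mult.assoc)
  qed
  moreover have "G ?a \<bullet> v \<le> L * inexactness k * norm v + G ?m \<bullet> v"
  proof -
    have "(G ?a - G ?m) \<bullet> v = block_of blk i (G ?a - G ?m) \<bullet> v"
      using inner_block_of_swap[of blk i "G ?a - G ?m" v] by (simp add: bv)
    also have "\<dots> \<le> norm (block_of blk i (G ?a - G ?m)) * norm v"
      by (rule norm_cauchy_schwarz)
    also have "\<dots> \<le> (L * norm (?a - ?m)) * norm v"
      using G_lipschitz[OF i _ m, of ?a] aP P_subset_Pbar by (intro mult_right_mono) auto
    also have "\<dots> \<le> (L * inexactness k) * norm v"
      using norm_mixed_gap[of k i] L_pos by (intro mult_right_mono mult_left_mono) auto
    finally show ?thesis by (simp add: inner_diff_left)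
  qed
  moreover have "G ?m \<bullet> v \<le> M * inexactness k * norm v - L * (norm v)\<^sup>2"
  proof -
    let ?s = "\<sigma> k i"
    have s: "0 < ?s" "?s \<le> M" "L \<le> ?s"
      using sigma_pos[OF i, of k] sigma_bounds[OF i, of k] L_le_Ml by auto
    have "0 \<le> (x_tilde blk f \<sigma> z k i - ?b) \<bullet> v"
      using y_block(2)[OF i P_block[OF y_in_P i], of k k] by (simp add: v inner_diff_right)
    also have "x_tilde blk f \<sigma> z k i - ?b
        = block_of blk i (z k - y k) - v - (1 / ?s) *\<^sub>R block_of blk i (G ?m)"
      by (simp add: x_tilde_def block_grad_G v block_of_diff)
    also have "\<dots> \<bullet> v = block_of blk i (z k - y k) \<bullet> v - (norm v)\<^sup>2 - (1 / ?s) * (G ?m \<bullet> v)"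
      using inner_block_of_swap[of blk i "G ?m" v]
      by (simp add: inner_diff_left power2_norm_eq_inner bv)
    finally have "(1 / ?s) * (G ?m \<bullet> v) \<le> block_of blk i (z k - y k) \<bullet> v - (norm v)\<^sup>2" by simp
    also have "block_of blk i (z k - y k) \<bullet> v \<le> norm (block_of blk i (z k - y k)) * norm v"
      by (rule norm_cauchy_schwarz)
    also have "norm (block_of blk i (z k - y k)) \<le> inexactness k"
      using norm_block_of_le[of blk i "z k - y k"] norm_minus_commute[of "z k" "y k"]
        norm_ge_zero[of "y (Suc k) - z (Suc k)"] unfolding inexactness_def by linarith
    finally have "(1 / ?s) * (G ?m \<bullet> v) \<le> inexactness k * norm v - (norm v)\<^sup>2" by (simp add: mult_right_mono)
    then have "G ?m \<bullet> v \<le> ?s * (inexactness k * norm v) - ?s * (norm v)\<^sup>2"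
      using s by (simp add: field_simps)
    moreover have "?s * (inexactness k * norm v) \<le> M * (inexactness k * norm v)"
      using s E0 by (intro mult_right_mono) auto
    moreover have "L * (norm v)\<^sup>2 \<le> ?s * (norm v)\<^sup>2" using s by (intro mult_right_mono) auto
    ultimately show ?thesis by (simp add: mult.assoc)
  qed
  ultimately have "f (?a + v) \<le> f ?a + (L + M) * inexactness k * norm v - L / 2 * (norm v)\<^sup>2"
    by (simp add: algebra_simps)
  moreover have "(L + M) * inexactness k * norm v \<le> L / 4 * (norm v)\<^sup>2 + (L + M)\<^sup>2 / L * (inexactness k)\<^sup>2"
  proof -
    have "0 \<le> L * (norm v / 2 - (L + M) * inexactness k / L)\<^sup>2" using L_pos by simp
    also have "\<dots> = L / 4 * (norm v)\<^sup>2 + (L + M)\<^sup>2 / L * (inexactness k)\<^sup>2 - (L + M) * inexactness k * norm v"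
      using L_pos by (simp add: power2_diff power_mult_distrib power_divide field_simps power2_eq_square)
    finally show ?thesis by simp
  qed
  ultimately show ?thesis unfolding succ by simp
qed

lemma descent:
  assumes m: "\<And>i. mixed blk z k i \<in> Pbar"
  shows "f (y (Suc k)) + L / 4 * (norm (y (Suc k) - y k))\<^sup>2 \<le> f (y k) + real n * ((L + M)\<^sup>2 / L) * (inexactness k)\<^sup>2"
proof -
  have "f (y (Suc k)) - f (y k) = (\<Sum>i\<in>{1..n}. f (mixed blk y k (Suc i)) - f (mixed blk y k i))"
    using sum_Suc_diff[of 1 n "\<lambda>i. f (mixed blk y k i)"] n_pos
    by (simp add: mixed_last[OF blocks] mixed_1[OF blocks, unfolded One_nat_def])
  also have "\<dots> \<le> (\<Sum>i\<in>{1..n}. (L + M)\<^sup>2 / L * (inexactness k)\<^sup>2 - L / 4 * (norm (block_of blk i (y (Suc k) - y k)))\<^sup>2)"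
    using block_descent m by (intro sum_mono) fastforce
  also have "\<dots> = real n * ((L + M)\<^sup>2 / L * (inexactness k)\<^sup>2) - L / 4 * (norm (y (Suc k) - y k))\<^sup>2"
    unfolding norm_power2_eq_sum_blocks[OF blocks, of "y (Suc k) - y k"]
    by (simp add: sum_subtractf sum_distrib_left)
  finally show ?thesis by simp
qed

text \<open>
  Summed over the blocks, the optimality conditions of the subproblems say that a vector \<open>\<xi>\<close> has
  nonnegative inner product with all feasible directions at \<open>y (Suc k)\<close>.  It differs from the
  gradient there only because the subproblems use the gradient at mixed iterates and a quadratic term,
  and that difference is the approximate subgradient.
\<close>

lemma approximate_stationarity:
  assumes m: "\<And>i. mixed blk z k i \<in> Pbar"
  obtains u where "norm u \<le> real n * (L + M) * (norm (y (Suc k) - y k) + inexactness k)"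
    "\<And>w. w \<in> P \<Longrightarrow> 0 \<le> (G (y (Suc k)) - u) \<bullet> (w - y (Suc k))"
proof -
  define g where "g i = block_of blk i (G (mixed blk z k i) + \<sigma> k i *\<^sub>R (y (Suc k) - z k))" for i
  define \<xi> where "\<xi> = (\<Sum>i\<in>{1..n}. g i)"
  define d where "d = norm (y (Suc k) - y k)"
  have d0: "0 \<le> d" by (simp add: d_def)
  have E0: "0 \<le> inexactness k" by (simp add: inexactness_def)
  have "0 \<le> \<xi> \<bullet> (w - y (Suc k))" if w: "w \<in> P" for w
  proof -
    have "0 \<le> g i \<bullet> (w - y (Suc k))" if i: "i \<in> {1..n}" for i
    proof -
      have s: "0 < \<sigma> k i" by (rule sigma_pos[OF i])
      have gi: "g i = - (\<sigma> k i *\<^sub>R (x_tilde blk f \<sigma> z k i - block_of blk i (y (Suc k))))"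
        using s by (simp add: g_def x_tilde_def block_grad_G block_of_add block_of_diff block_of_scaleR algebra_simps)
      have "g i \<bullet> (w - y (Suc k)) = g i \<bullet> block_of blk i (w - y (Suc k))"
        by (simp add: g_def inner_block_of_block_of inner_block_of_swap[symmetric])
      also have "\<dots> = - (\<sigma> k i * ((x_tilde blk f \<sigma> z k i - block_of blk i (y (Suc k)))
          \<bullet> (block_of blk i w - block_of blk i (y (Suc k)))))"
        unfolding gi by (simp add: block_of_diff)
      also have "\<dots> \<ge> 0"
        using y_block(2)[OF i P_block[OF w i], of k] s by (simp add: mult_nonneg_nonpos)
      finally show ?thesis .
    qed
    then show ?thesis unfolding \<xi>_def inner_sum_left by (rule sum_nonneg)
  qed
  moreover have "norm (G (y (Suc k)) - \<xi>) \<le> real n * (L + M) * (d + inexactness k)"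
  proof -
    have "norm (block_of blk i (G (y (Suc k))) - g i) \<le> (L + M) * (d + inexactness k)" if i: "i \<in> {1..n}" for i
    proof -
      let ?m = "mixed blk z k i"
      have "block_of blk i (G (y (Suc k))) - g i
          = block_of blk i (G (y (Suc k)) - G ?m) - \<sigma> k i *\<^sub>R block_of blk i (y (Suc k) - z k)"
        by (simp add: g_def block_of_add block_of_diff block_of_scaleR algebra_simps)
      then have "norm (block_of blk i (G (y (Suc k))) - g i)
          \<le> norm (block_of blk i (G (y (Suc k)) - G ?m)) + \<sigma> k i * norm (block_of blk i (y (Suc k) - z k))"
        using norm_triangle_ineq4[of "block_of blk i (G (y (Suc k)) - G ?m)"
            "\<sigma> k i *\<^sub>R block_of blk i (y (Suc k) - z k)"] sigma_pos[OF i, of k] by simp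
      also have "\<dots> \<le> L * (d + inexactness k) + M * (d + inexactness k)"
      proof (intro add_mono mult_mono)
        have "norm (block_of blk i (G (y (Suc k)) - G ?m)) \<le> L * norm (y (Suc k) - ?m)"
          using G_lipschitz[OF i _ m] y_in_P P_subset_Pbar by blast
        also have "norm (y (Suc k) - ?m) \<le> d + inexactness k"
        proof -
          have "norm (y (Suc k) - mixed blk y k i) \<le> d"
            using norm_mixed_diff_le[of blk "\<lambda>_. y (Suc k)" k i y] by (simp add: mixed_def d_def)
          then show ?thesis
            using norm_mixed_gap[of k i] norm_triangle_ineq[of "y (Suc k) - mixed blk y k i" "mixed blk y k i - ?m"]
            by simp
        qed
        finally show "norm (block_of blk i (G (y (Suc k)) - G ?m)) \<le> L * (d + inexactness k)"
          using L_pos by (simp add: mult_left_mono)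
        have "norm (y (Suc k) - z k) \<le> d + norm (y k - z k)"
          using norm_triangle_ineq[of "y (Suc k) - y k" "y k - z k"] by (simp add: d_def)
        then show "norm (block_of blk i (y (Suc k) - z k)) \<le> d + inexactness k"
          using norm_block_of_le[of blk i "y (Suc k) - z k"] norm_ge_zero[of "y (Suc k) - z (Suc k)"]
          unfolding inexactness_def by linarith
      qed (use sigma_bounds(2)[OF i] M_pos in auto)
      finally show ?thesis by (simp add: algebra_simps)
    qed
    then have "(\<Sum>i\<in>{1..n}. norm (block_of blk i (G (y (Suc k))) - g i)) \<le> (\<Sum>i\<in>{1..n}. (L + M) * (d + inexactness k))"
      by (rule sum_mono)
    moreover have "G (y (Suc k)) - \<xi> = (\<Sum>i\<in>{1..n}. block_of blk i (G (y (Suc k))) - g i)"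
      by (simp only: sum_subtractf \<xi>_def sum_block_of[OF blocks])
    moreover have "norm (\<Sum>i\<in>{1..n}. block_of blk i (G (y (Suc k))) - g i)
        \<le> (\<Sum>i\<in>{1..n}. norm (block_of blk i (G (y (Suc k))) - g i))" by (rule norm_sum)
    ultimately show ?thesis by simp
  qed
  ultimately show thesis using that[of "G (y (Suc k)) - \<xi>"] by (simp add: d_def)
qed

lemma perturbed_descent:
  obtains a C K where "0 < a" "0 < C"
    "\<And>k. K \<le> k \<Longrightarrow> norm (y k - z k) \<le> C * \<rho> ^ k"
    "\<And>k. K \<le> k \<Longrightarrow> f (y (Suc k)) + a * (norm (y (Suc k) - y k))\<^sup>2 \<le> f (y k) + C * (\<rho> ^ k)\<^sup>2"
    "\<And>k. K \<le> k \<Longrightarrow> \<exists>u. norm u \<le> C * (norm (y (Suc k) - y k) + \<rho> ^ k) \<and>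
       (\<forall>w\<in>P. 0 \<le> (G (y (Suc k)) - u) \<bullet> (w - y (Suc k)))"
proof -
  obtain C0 K0 where C0: "0 < C0" "\<And>k. K0 \<le> k \<Longrightarrow> norm (y k - z k) \<le> C0 * \<rho> ^ k"
    by (rule inexactness_geometric) (rule that; blast)
  obtain K1 where K1: "\<And>k. K1 \<le> k \<Longrightarrow> z k \<in> Pbar" "\<And>k i. K1 \<le> k \<Longrightarrow> mixed blk z k i \<in> Pbar"
    by (rule eventually_Pbar) (rule that; blast)
  have E: "inexactness k \<le> 2 * C0 * \<rho> ^ k" if "K0 \<le> k" for k
  proof -
    have "C0 * \<rho> ^ Suc k \<le> C0 * \<rho> ^ k"
      using rho C0 by (intro mult_left_mono power_decreasing) auto
    then show ?thesis using C0(2)[of k] C0(2)[of "Suc k"] that unfolding inexactness_def by linarith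
  qed
  have E0: "0 \<le> inexactness k" for k by (simp add: inexactness_def)
  define A where "A = real n * ((L + M)\<^sup>2 / L)"
  define B where "B = real n * (L + M)"
  have A: "0 \<le> A" "0 \<le> B" using L_pos M_pos by (auto simp: A_def B_def)
  define C where "C = C0 + A * (2 * C0)\<^sup>2 + B * (1 + 2 * C0)"
  have C: "C0 \<le> C" "A * (2 * C0)\<^sup>2 \<le> C" "B * (1 + 2 * C0) \<le> C"
    using A C0(1) by (auto simp: C_def)
  show thesis
  proof (rule that)
    show "0 < L / 4" "0 < C" using L_pos C C0(1) by auto
    fix k assume k: "max K0 K1 \<le> k"
    have r: "0 < \<rho> ^ k" using rho by simp
    have "C0 * \<rho> ^ k \<le> C * \<rho> ^ k" using C r by (intro mult_right_mono) auto
    then show "norm (y k - z k) \<le> C * \<rho> ^ k" using C0(2)[of k] k by simp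
    have "A * (inexactness k)\<^sup>2 \<le> A * (2 * C0 * \<rho> ^ k)\<^sup>2"
      using E[of k] E0[of k] A k by (intro mult_left_mono power_mono) auto
    also have "\<dots> = A * (2 * C0)\<^sup>2 * (\<rho> ^ k)\<^sup>2" by (simp add: power_mult_distrib)
    also have "\<dots> \<le> C * (\<rho> ^ k)\<^sup>2" using C by (intro mult_right_mono) auto
    finally show "f (y (Suc k)) + L / 4 * (norm (y (Suc k) - y k))\<^sup>2 \<le> f (y k) + C * (\<rho> ^ k)\<^sup>2"
      using descent[of k] K1(2)[of k] k by (simp add: A_def)
    obtain u where u: "norm u \<le> B * (norm (y (Suc k) - y k) + inexactness k)"
      "\<And>w. w \<in> P \<Longrightarrow> 0 \<le> (G (y (Suc k)) - u) \<bullet> (w - y (Suc k))"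
      using approximate_stationarity[of k] K1(2)[of k] k unfolding B_def by auto
    have "B * (norm (y (Suc k) - y k) + inexactness k) \<le> B * ((1 + 2 * C0) * (norm (y (Suc k) - y k) + \<rho> ^ k))"
    proof (intro mult_left_mono)
      have "0 \<le> 2 * C0 * norm (y (Suc k) - y k)" using C0 by simp
      then show "norm (y (Suc k) - y k) + inexactness k \<le> (1 + 2 * C0) * (norm (y (Suc k) - y k) + \<rho> ^ k)"
        using E[of k] k r by (simp add: algebra_simps)
    qed (rule A)
    also have "\<dots> \<le> C * (norm (y (Suc k) - y k) + \<rho> ^ k)"
      unfolding mult.assoc[symmetric] using C r by (intro mult_right_mono) auto
    finally show "\<exists>u. norm u \<le> C * (norm (y (Suc k) - y k) + \<rho> ^ k) \<and>
       (\<forall>w\<in>P. 0 \<le> (G (y (Suc k)) - u) \<bullet> (w - y (Suc k)))"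
      using u by (intro exI[of _ u]) auto
  qed
qed

lemma f_continuous: "continuous_on UNIV f"
  using f_diff by (rule differentiable_imp_continuous_on)

abbreviation F :: "real ^ 'N \<Rightarrow> ereal" where "F \<equiv> objective blk n p f h"

lemma F_eq: "F w = (if w \<in> P then ereal (f w) else \<infinity>)"
  unfolding P_def by (rule objective_eq)

lemma subdiffI:
  assumes "x \<in> P" "\<And>w. w \<in> P \<Longrightarrow> 0 \<le> (G x - u) \<bullet> (w - x)"
  shows "u \<in> frechet_subdiff F x"
  by (rule frechet_subdiff_constrained[OF F_eq assms(1) G_derivative assms(2)])

lemma y_minus_z_tendsto_0: "(\<lambda>k. y k - z k) \<longlonglongrightarrow> 0"
proof -
  obtain C K where C: "0 < C" "\<And>k. K \<le> k \<Longrightarrow> norm (y k - z k) \<le> C * \<rho> ^ k"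
    by (rule inexactness_geometric) (rule that; blast)
  have "(\<lambda>k. C * \<rho> ^ k) \<longlonglongrightarrow> C * 0"
    using rho by (intro tendsto_mult_left LIMSEQ_realpow_zero) auto
  then have "(\<lambda>k. C * \<rho> ^ k) \<longlonglongrightarrow> 0" by simp
  moreover have "\<forall>\<^sub>F k in sequentially. norm (y k - z k) \<le> C * \<rho> ^ k"
    using C by (auto simp: eventually_sequentially)
  ultimately show ?thesis by (rule Lim_null_comparison[rotated])
qed

lemma subsequence_y:
  assumes "strict_mono r" "(z \<circ> r) \<longlonglongrightarrow> x"
  shows "(y \<circ> r) \<longlonglongrightarrow> x"
  using tendsto_add[OF LIMSEQ_subseq_LIMSEQ[OF y_minus_z_tendsto_0 assms(1)] assms(2)]
  by (simp add: o_def)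

lemma limit_in_P:
  assumes "(y \<circ> r) \<longlonglongrightarrow> x"
  shows "x \<in> P"
  using closed_sequentially[OF P_closed _ assms] y_in_P by simp

lemma G_tendsto:
  assumes "\<And>k. a k \<in> P" "x \<in> P" "a \<longlonglongrightarrow> x"
  shows "(\<lambda>k. G (a k)) \<longlonglongrightarrow> G x"
proof -
  have bound: "norm (G (a k) - G x) \<le> real n * L * norm (a k - x)" for k
  proof -
    have "norm (G (a k) - G x) \<le> (\<Sum>i\<in>{1..n}. norm (block_of blk i (G (a k) - G x)))"
      by (rule norm_le_sum_blocks[OF blocks])
    also have "\<dots> \<le> (\<Sum>i\<in>{1..n}. L * norm (a k - x))"
      using G_lipschitz assms P_subset_Pbar by (intro sum_mono) blast
    finally show ?thesis by simp
  qed
  have "(\<lambda>k. real n * L * norm (a k - x)) \<longlonglongrightarrow> real n * L * norm (x - x)"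
    using assms(3) by (intro tendsto_intros)
  then have "(\<lambda>k. real n * L * norm (a k - x)) \<longlonglongrightarrow> 0" by simp
  then have "(\<lambda>k. G (a k) - G x) \<longlonglongrightarrow> 0"
    by (rule Lim_null_comparison[rotated]) (simp add: bound)
  then show ?thesis by (simp add: LIM_zero_iff)
qed

text \<open>
  The steps tend to 0 because the objective is bounded below on the compact feasible set, hence so do
  the approximate subgradients, and their variational inequalities pass to the limit.
\<close>

lemma limit_points_stationary:
  assumes r: "strict_mono r" "(z \<circ> r) \<longlonglongrightarrow> x"
  shows "stationary F x"
proof -
  obtain a C K where a: "0 < a" "0 < C"
    and "\<And>k. K \<le> k \<Longrightarrow> norm (y k - z k) \<le> C * \<rho> ^ k"
    and desc: "\<And>k. K \<le> k \<Longrightarrow> f (y (Suc k)) + a * (norm (y (Suc k) - y k))\<^sup>2 \<le> f (y k) + C * (\<rho> ^ k)\<^sup>2"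
    and sub: "\<And>k. K \<le> k \<Longrightarrow> \<exists>u. norm u \<le> C * (norm (y (Suc k) - y k) + \<rho> ^ k) \<and>
       (\<forall>w\<in>P. 0 \<le> (G (y (Suc k)) - u) \<bullet> (w - y (Suc k)))"
    by (rule perturbed_descent) (rule that; blast)
  obtain B where B: "0 < B" "\<And>k. K \<le> k \<Longrightarrow>
      (f (y (Suc k)) + B * (\<rho> ^ Suc k)\<^sup>2) + a / 2 * (norm (y (Suc k) - y k) + \<rho> ^ k)\<^sup>2
      \<le> f (y k) + B * (\<rho> ^ k)\<^sup>2"
    by (rule descent_with_geometric_error[of a \<rho> C K "\<lambda>k. f (y k)" y]) (use a rho desc in auto)
  define \<psi> where "\<psi> k = f (y k) + B * (\<rho> ^ k)\<^sup>2" for k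
  define s where "s k = norm (y (Suc k) - y k) + \<rho> ^ k" for k
  have dec: "\<psi> (Suc k) + a / 2 * (s k)\<^sup>2 \<le> \<psi> k" if "K \<le> k" for k
    using B(2)[OF that] by (simp add: \<psi>_def s_def)
  have "compact (f ` P)"
    using P_compact continuous_on_subset[OF f_continuous] by (intro compact_continuous_image) auto
  then obtain R where R: "\<And>w. w \<in> P \<Longrightarrow> \<bar>f w\<bar> \<le> R"
    using compact_imp_bounded by (force simp: bounded_iff)
  have "s \<longlonglongrightarrow> 0"
  proof (rule steps_vanish_of_descent[of "a / 2" K \<psi> s])
    show "0 < a / 2" using a by simp
    show "\<psi> (Suc k) + a / 2 * (s k)\<^sup>2 \<le> \<psi> k" if "K \<le> k" for k by (rule dec[OF that])
    have "\<psi> (Suc k) \<le> \<psi> k" if "K \<le> k" for k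
    proof -
      have "0 \<le> a / 2 * (s k)\<^sup>2" using a by simp
      then show ?thesis using dec[OF that] by linarith
    qed
    moreover have "- R \<le> \<psi> k" for k
    proof -
      have "0 \<le> B * (\<rho> ^ k)\<^sup>2" using B(1) by simp
      then show ?thesis using R[OF y_in_P[of k]] unfolding \<psi>_def by linarith
    qed
    ultimately show "convergent \<psi>"
      unfolding convergent_def by (rule decreasing_convergent_from[of K \<psi> "- R"]) blast+
  qed
  obtain u where u: "\<And>k. K \<le> k \<Longrightarrow> norm (u k) \<le> C * s k"
    "\<And>k w. K \<le> k \<Longrightarrow> w \<in> P \<Longrightarrow> 0 \<le> (G (y (Suc k)) - u k) \<bullet> (w - y (Suc k))"
  proof -
    have "\<exists>u. K \<le> k \<longrightarrow> norm u \<le> C * s k \<and> (\<forall>w\<in>P. 0 \<le> (G (y (Suc k)) - u) \<bullet> (w - y (Suc k)))" for k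
      using sub unfolding s_def by blast
    then obtain u where "\<And>k. K \<le> k \<longrightarrow> norm (u k) \<le> C * s k
        \<and> (\<forall>w\<in>P. 0 \<le> (G (y (Suc k)) - u k) \<bullet> (w - y (Suc k)))" by metis
    then show ?thesis by (intro that[of u]) blast+
  qed
  have "(\<lambda>k. C * s k) \<longlonglongrightarrow> C * 0" using \<open>s \<longlonglongrightarrow> 0\<close> by (rule tendsto_mult_left)
  then have "(\<lambda>k. C * s k) \<longlonglongrightarrow> 0" by simp
  then have u0: "u \<longlonglongrightarrow> 0"
    by (rule Lim_null_comparison[rotated]) (use u(1) in \<open>auto simp: eventually_sequentially\<close>)
  then have "(\<lambda>k. u (k - 1)) \<longlonglongrightarrow> 0" by - (rule LIMSEQ_imp_Suc, simp)
  then have u0: "(\<lambda>j. u (r j - 1)) \<longlonglongrightarrow> 0"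
    using LIMSEQ_subseq_LIMSEQ[OF _ r(1)] by (fastforce simp: o_def)
  have yx: "(\<lambda>j. y (r j)) \<longlonglongrightarrow> x" using subsequence_y[OF r] by (simp add: o_def)
  have xP: "x \<in> P" using limit_in_P[OF subsequence_y[OF r]] .
  have "0 \<le> (G x - 0) \<bullet> (w - x)" if w: "w \<in> P" for w
  proof (rule tendsto_lowerbound)
    show "(\<lambda>j. (G (y (r j)) - u (r j - 1)) \<bullet> (w - y (r j))) \<longlonglongrightarrow> (G x - 0) \<bullet> (w - x)"
      by (intro tendsto_intros G_tendsto u0 yx xP y_in_P)
    have "0 \<le> (G (y (r j)) - u (r j - 1)) \<bullet> (w - y (r j))" if j: "Suc K \<le> j" for j
    proof -
      obtain l where "r j = Suc l" "K \<le> l"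
        using j seq_suble[OF r(1), of j] by (cases "r j") auto
      then show ?thesis using u(2)[OF _ w, of l] by simp
    qed
    then show "\<forall>\<^sub>F j in sequentially. 0 \<le> (G (y (r j)) - u (r j - 1)) \<bullet> (w - y (r j))"
      by (auto simp: eventually_sequentially)
  qed simp
  then show ?thesis unfolding stationary_def by (intro subdiffI xP)
qed

section \<open>Convergence rates\<close>

text \<open>
  The rate of \<open>y\<close> carries over to \<open>z\<close>, for the geometric distance between them is dominated by a
  geometric sequence with the larger ratio and by every negative power.
\<close>

lemma rate_at_limit_point:
  assumes lp: "limit_point z x" and loj: "lojasiewicz_exponent F x \<theta>"
  shows "z \<longlonglongrightarrow> x"
    and "\<theta> \<le> 1 / 2 \<Longrightarrow> \<exists>q. 0 < q \<and> q < 1 \<and> eventually_le_O (\<lambda>k. norm (z k - x)) (\<lambda>k. q ^ k)"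
    and "1 / 2 < \<theta> \<Longrightarrow>
      eventually_le_O (\<lambda>k. norm (z k - x)) (\<lambda>k. real k powr (- ((1 - \<theta>) / (2 * \<theta> - 1))))"
proof -
  obtain r where r: "strict_mono r" "(z \<circ> r) \<longlonglongrightarrow> x" using lp by (auto simp: limit_point_def)
  have yx: "(y \<circ> r) \<longlonglongrightarrow> x" by (rule subsequence_y[OF r])
  have xP: "x \<in> P" by (rule limit_in_P[OF yx])
  have fx: "((\<lambda>k. f (y k)) \<circ> r) \<longlonglongrightarrow> f x"
    using continuous_on_tendsto_compose[OF f_continuous yx] by (simp add: o_def)
  have \<theta>: "0 \<le> \<theta>" "\<theta> < 1" using loj by (auto simp: lojasiewicz_exponent_def)
  obtain c \<eta> where c: "0 < c" "0 < \<eta>" "\<And>w u. w \<in> P \<Longrightarrow> w \<in> cball x \<eta> \<Longrightarrow> u \<in> frechet_subdiff F w \<Longrightarrow>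
      \<bar>f w - f x\<bar> powr \<theta> \<le> c * norm u"
    using lojasiewicz_exponent_constrained[OF F_eq xP loj] by blast
  obtain a C K where a: "0 < a" "0 < C"
    and gap: "\<And>k. K \<le> k \<Longrightarrow> norm (y k - z k) \<le> C * \<rho> ^ k"
    and desc: "\<And>k. K \<le> k \<Longrightarrow> f (y (Suc k)) + a * (norm (y (Suc k) - y k))\<^sup>2 \<le> f (y k) + C * (\<rho> ^ k)\<^sup>2"
    and sub: "\<And>k. K \<le> k \<Longrightarrow> \<exists>u. norm u \<le> C * (norm (y (Suc k) - y k) + \<rho> ^ k) \<and>
       (\<forall>w\<in>P. 0 \<le> (G (y (Suc k)) - u) \<bullet> (w - y (Suc k)))"
    by (rule perturbed_descent) (rule that; blast)
  define D where "D = C + c * C"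
  have D: "0 \<le> D" "C \<le> D" "c * C \<le> D" using a c by (auto simp: D_def)
  have desc': "f (y (Suc k)) + a * (norm (y (Suc k) - y k))\<^sup>2 \<le> f (y k) + D * (\<rho> ^ k)\<^sup>2" if "K \<le> k" for k
    using desc[OF that] D mult_right_mono[OF D(2), of "(\<rho> ^ k)\<^sup>2"] by simp
  have loj': "\<bar>f (y (Suc k)) - f x\<bar> powr \<theta> \<le> D * (norm (y (Suc k) - y k) + \<rho> ^ k)"
    if k: "K \<le> k" and near: "y (Suc k) \<in> cball x \<eta>" for k
  proof -
    obtain u where u: "norm u \<le> C * (norm (y (Suc k) - y k) + \<rho> ^ k)"
      "\<And>w. w \<in> P \<Longrightarrow> 0 \<le> (G (y (Suc k)) - u) \<bullet> (w - y (Suc k))"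
      using sub[OF k] by blast
    have "\<bar>f (y (Suc k)) - f x\<bar> powr \<theta> \<le> c * norm u"
      by (rule c(3)[OF y_in_P near subdiffI[OF y_in_P u(2)]])
    also have "\<dots> \<le> c * (C * (norm (y (Suc k) - y k) + \<rho> ^ k))"
      using u(1) c by (intro mult_left_mono) auto
    also have "\<dots> \<le> D * (norm (y (Suc k) - y k) + \<rho> ^ k)"
      unfolding mult.assoc[symmetric] using D rho by (intro mult_right_mono) auto
    finally show ?thesis .
  qed
  note rates = inexact_descent_rate[OF a(1) rho D(1) c(2) \<theta> desc' loj' r(1) yx fx]
  have yx_lim: "y \<longlonglongrightarrow> x"
    by (rule rates(1); assumption)
  have y_geometric: "\<exists>q. 0 < q \<and> q < 1 \<and> eventually_le_O (\<lambda>k. norm (y k - x)) (\<lambda>k. q ^ k)" if "\<theta> \<le> 1 / 2"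
    using that by - (rule rates(2); assumption)
  have y_sublinear: "eventually_le_O (\<lambda>k. norm (y k - x)) (\<lambda>k. real k powr (- ((1 - \<theta>) / (2 * \<theta> - 1))))"
    if "1 / 2 < \<theta>"
    using that by - (rule rates(3); assumption)
  have "(\<lambda>k. y k - (y k - z k)) \<longlonglongrightarrow> x - 0"
    by (intro tendsto_diff yx_lim y_minus_z_tendsto_0)
  then show "z \<longlonglongrightarrow> x" by simp
  have gapO: "eventually_le_O (\<lambda>k. norm (y k - z k)) (\<lambda>k. \<rho> ^ k)"
    by (rule eventually_le_O_I[of _ C]) (use gap in \<open>auto simp: eventually_sequentially\<close>)
  have transfer: "eventually_le_O (\<lambda>k. norm (z k - x)) b"
    if yb: "eventually_le_O (\<lambda>k. norm (y k - x)) b" and rb: "eventually_le_O (\<lambda>k. \<rho> ^ k) b" for b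
  proof -
    have "eventually_le_O (\<lambda>k. norm (y k - z k)) b"
      using eventually_le_O_trans[OF gapO rb] rho by simp
    then have sum: "eventually_le_O (\<lambda>k. norm (y k - x) + norm (y k - z k)) b"
      by (rule eventually_le_O_add[OF yb])
    have "norm (z k - x) \<le> norm (y k - x) + norm (y k - z k)" for k
      using norm_triangle_ineq4[of "y k - x" "y k - z k"] by simp
    then have tri: "eventually_le_O (\<lambda>k. norm (z k - x)) (\<lambda>k. norm (y k - x) + norm (y k - z k))"
      by (intro eventually_le_O_I[of _ 1]) simp
    show ?thesis by (rule eventually_le_O_trans[OF tri sum]) simp
  qed
  show "\<exists>q. 0 < q \<and> q < 1 \<and> eventually_le_O (\<lambda>k. norm (z k - x)) (\<lambda>k. q ^ k)" if small: "\<theta> \<le> 1 / 2"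
  proof -
    obtain q where q: "0 < q" "q < 1" "eventually_le_O (\<lambda>k. norm (y k - x)) (\<lambda>k. q ^ k)"
      using y_geometric[OF small] by (elim exE conjE)
    have "eventually_le_O (\<lambda>k. norm (z k - x)) (\<lambda>k. max q \<rho> ^ k)"
    proof (rule transfer)
      show "eventually_le_O (\<lambda>k. norm (y k - x)) (\<lambda>k. max q \<rho> ^ k)"
        by (rule eventually_le_O_trans[OF q(3) eventually_le_O_power]) (use q in auto)
      show "eventually_le_O (\<lambda>k. \<rho> ^ k) (\<lambda>k. max q \<rho> ^ k)"
        by (rule eventually_le_O_power) (use rho in auto)
    qed
    then show ?thesis using q rho by (intro exI[of _ "max q \<rho>"]) auto
  qed
  show "eventually_le_O (\<lambda>k. norm (z k - x)) (\<lambda>k. real k powr (- ((1 - \<theta>) / (2 * \<theta> - 1))))" if "1 / 2 < \<theta>"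
    by (rule transfer[OF y_sublinear[OF that] eventually_le_O_power_powr[OF rho]]) (use that \<theta> in simp)
qed

lemma limit_point_exists: "\<exists>x. limit_point z x"
proof -
  obtain x r where r: "strict_mono r" "(y \<circ> r) \<longlonglongrightarrow> x"
    using P_compact y_in_P unfolding compact_def by blast
  have "(\<lambda>j. y (r j) - (y (r j) - z (r j))) \<longlonglongrightarrow> x - 0"
    using r(2) LIMSEQ_subseq_LIMSEQ[OF y_minus_z_tendsto_0 r(1)]
    by (intro tendsto_diff) (auto simp: o_def)
  then show ?thesis using r(1) by (auto simp: limit_point_def o_def)
qed

end

theorem theorem5p2:
  fixes blk :: "'N::finite \<Rightarrow> nat" and n :: nat and p :: "nat \<Rightarrow> nat"
    and f :: "real ^ 'N \<Rightarrow> real" and h :: "nat \<Rightarrow> nat \<Rightarrow> real ^ 'N \<Rightarrow> real"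
    and \<epsilon>bar \<rho> \<gamma> L Ml M \<theta> :: real and \<epsilon> Ls :: "nat \<Rightarrow> real" and \<sigma> :: "nat \<Rightarrow> nat \<Rightarrow> real"
    and z :: "nat \<Rightarrow> real ^ 'N" and zb0 zbar :: "real ^ 'N" and Fbar :: ereal
  assumes blocks: "range blk = {1..n}"
    and p_pos: "\<forall>i\<in>{1..n}. 1 \<le> p i"
    and f_diff: "f differentiable_on UNIV"
    and h_convex_diff: "\<forall>i\<in>{1..n}. \<forall>l\<in>{1..p i}.
          convex_on (block_space blk i) (h i l) \<and> h i l differentiable_on block_space blk i"
    and L_def: "L = (MAX i\<in>{1..n}. Ls i)"
    and gamma: "1 < \<gamma>" and Ml_def: "Ml = \<gamma> * L" and M_ge: "Ml \<le> M"
    and rho: "0 < \<rho>" "\<rho> < 1" and eps: "\<forall>k. \<epsilon> k = \<epsilon>bar * \<rho> ^ k"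
    and palm: "palm_I blk n p f h \<epsilon>bar \<epsilon> Ml M \<sigma> z"
    and zb0: "zb0 \<in> block_prod blk n (feas blk p h)"
    and hyp1: "\<forall>i\<in>{1..n}. 0 < Ls i \<and>
          (\<forall>z1\<in>block_prod blk n (feas_bar blk p h \<epsilon>bar).
           \<forall>z2\<in>block_prod blk n (feas_bar blk p h \<epsilon>bar).
             norm (block_grad blk f i z1 - block_grad blk f i z2) \<le> Ls i * norm (z1 - z2))"
    and hyp2: "\<forall>i\<in>{1..n}. convex (feas blk p h i) \<and> compact (feas blk p h i) \<and>
          (linear_constraints blk p h i \<or> slater blk p h i) \<and>
          (\<exists>c\<ge>0. \<forall>x\<in>feas_tilde blk n p f h \<epsilon>bar Ml i.
             infdist x (feas blk p h i) \<le> c * L2_set (\<lambda>l. max (h i l x) 0) {1..p i})"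
    and hyp3: "\<forall>x. stationary (objective blk n p f h) x \<longrightarrow> lojasiewicz (objective blk n p f h) x"
    and hyp4: "\<exists>\<theta>'. 0 < \<theta>' \<and> \<theta>' < 1 \<and> summable (\<lambda>k. e_seq \<epsilon> k powr \<theta>')" "summable \<epsilon>"
    and zbar_def: "zbar = (THE l. limit_point z l)"
    and theta: "lojasiewicz_exponent (objective blk n p f h) zbar \<theta>"
    and Fbar_def: "Fbar = lim (v_seq blk n p f h \<gamma> L \<sigma> z zb0)"
    and v_gt: "\<forall>k. v_seq blk n p f h \<gamma> L \<sigma> z zb0 k > Fbar"
  shows "(\<theta> = 0 \<longrightarrow>
           (\<exists>\<rho>1. 0 < \<rho>1 \<and> \<rho>1 < 1 \<and> eventually_le_O (\<lambda>k. norm (z k - zbar)) (\<lambda>k. \<rho>1 ^ k))) \<and>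
         (0 < \<theta> \<and> \<theta> \<le> 1 / 2 \<longrightarrow>
           (\<exists>\<rho>2. 0 < \<rho>2 \<and> \<rho>2 < 1 \<and> eventually_le_O (\<lambda>k. norm (z k - zbar)) (\<lambda>k. \<rho>2 ^ k))) \<and>
         (1 / 2 < \<theta> \<and> \<theta> < 1 \<longrightarrow>
           eventually_le_O (\<lambda>k. norm (z k - zbar)) (\<lambda>k. real k powr (- ((1 - \<theta>) / (2 * \<theta> - 1)))))"
proof -
  interpret palm_run blk n p f h \<epsilon>bar \<rho> \<gamma> L Ml M \<epsilon> Ls \<sigma> z zb0
    using assms by unfold_locales blast+
  obtain x where x: "limit_point z x" using limit_point_exists by blast
  then have "stationary (objective blk n p f h) x"
    using limit_points_stationary by (auto simp: limit_point_def)
  then obtain \<theta>0 where "lojasiewicz_exponent (objective blk n p f h) x \<theta>0"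
    using hyp3 by (auto simp: lojasiewicz_def)
  \<comment> \<open>any exponent at \<open>x\<close> yields convergence, hence the uniqueness that makes \<open>zbar\<close> equal to \<open>x\<close>\<close>
  then have lim: "z \<longlonglongrightarrow> x" by (rule rate_at_limit_point(1)[OF x])
  have "l = x" if "limit_point z l" for l
    using that LIMSEQ_unique LIMSEQ_subseq_LIMSEQ[OF lim] by (auto simp: limit_point_def)
  then have "zbar = x" unfolding zbar_def using x by (intro the_equality)
  then have "limit_point z zbar" using x by simp
  note rate = rate_at_limit_point[OF this theta]
  show ?thesis using rate(2,3) by auto
qed

end
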